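(* Let $S_1,\dots,S_n$ be Polish spaces, let $\mathcal{H}_{1:n}\subset\prod_{k=1}^n\mathcal{L}_{S_k}$ be a family of sequential functions, let $Z_{1:n}=(Z_1,\dots,Z_n)$ be a random element of $\prod_{k=1}^nS_k$ with independent components, let $H_k(z_k)=\sup_{h_{1:n}\in\mathcal{H}_{1:n}}|h_k(z_k)|\in[0,\infty]$ for $1\le k\le n$, and let $$\tilde h_{1:n}\in\arg\min_{h_{1:n}\in\mathcal{H}_{1:n}}\sum_{k=1}^n\mathrm{E}[h_k(Z_k)],\qquad \hat h_{1:n}=\hat h_{1:n,Z_{1:n}}\in\arg\min_{h_{1:n}\in\mathcal{H}_{1:n}}\sum_{k=1}^nh_k(Z_k).$$ Then for any $\epsilon>0$ and any independent copy $Z'_{1:n}$ of $Z_{1:n}$, $$\mathrm{P}\left(\sum_{k=1}^n\mathrm{E}\big[\hat h_k(Z'_k)-\tilde h_k(Z'_k)\,\big|\,Z_{1:n}\big]>2\big(\epsilon+\mathcal{R}_{ave}(\mathcal{H}_{1:n},Z_{1:n})\big)\right)\le2\exp\left(-\left(\frac{\epsilon}{\sqrt2\,\big\|\,|H_{1:n}(Z_{1:n})|_{n,2}\big\|_{\mathrm{P},\infty}}\right)^2\right).$$ In particular, for any $\delta\in(0,2]$, the inequality $$\sum_{k=1}^n\mathrm{E}\big[\hat h_k(Z'_k)-\tilde h_k(Z'_k)\,\big|\,Z_{1:n}\big]\le2\left(\big\|\,|H_{1:n}(Z_{1:n})|_{n,2}\big\|_{\mathrm{P},\infty}\sqrt{2\log(2/\delta)}+\mathcal{R}_{ave}(\mathcal{H}_{1:n},Z_{1:n})\right)$$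 holds with probability at least $1-\delta$.
   Context: For a Polish space $S$, $\mathcal{L}_S$ is the set of Borel measurable functions $S\to\mathbb{R}$. Given Polish spaces $S_1,\dots,S_n$, a (nonempty) subset $\mathcal{H}_{1:n}\subset\prod_{k=1}^n\mathcal{L}_{S_k}$ is called a family of sequential functions; its elements are $h_{1:n}=(h_1,\dots,h_n)$ with $h_k:S_k\to\mathbb{R}$, and $h_{1:n}(z_{1:n})=(h_k(z_k))_{k=1}^n$. Standing assumption: every family $\mathcal{H}_{1:n}$ is pointwise measurable, i.e. there is a countable subfamily $(h^{(l)}_{1:n})_{l\in\mathbb{N}}\subset\mathcal{H}_{1:n}$ such that every $h_{1:n}\in\mathcal{H}_{1:n}$ is the pointwise limit (at all $z_{1:n}\in\prod_k S_k$) of some sequence $(h^{(l_m)}_{1:n})_m$. All expectations $\mathrm{E}[h_k(Z_k)]$ are assumed well defined, and the minimizers $\tilde h_{1:n}$ (deterministic) and $\hat h_{1:n}$ (depending on the sample $Z_{1:n}$) are assumed to exist. The conditional expectation $\mathrm{E}[\hat h_k(Z'_k)\mid Z_{1:n}]$ is the integral over the law of $Z'_k$ with the sample-dependent function $\hat h_k$ held fixed, i.e. the value of $\mathrm{E}[h_k(Z_k)]$ at $h_k=\hat h_k$. All random elements are Borel measurable maps on one fixed probability space $(\Omega,\mathcal{A},\mathrm{P})$. $\|Z\|_{\mathrm{P},\infty}=\inf\{z\in\mathbb{R}:\mathrm{P}(|Z|>z)=0\}$ (with $\inf\emptyset=\infty$), and $|a_{1:n}|_{n,2}=(\sum_{k=1}^n|a_k|^2)^{1/2}$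 for $a_{1:n}\in[-\infty,\infty]^n$, so $|H_{1:n}(Z_{1:n})|_{n,2}=(\sum_kH_k(Z_k)^2)^{1/2}$. A Rademacher sequence $U_{1:n}$ is an i.i.d. sequence with $\mathrm{P}(U_1=1)=\mathrm{P}(U_1=-1)=1/2$. The Rademacher complexity of $\mathcal{H}_{1:n}$ with respect to $Z_{1:n}$ is $\mathcal{R}_{ave}(\mathcal{H}_{1:n},Z_{1:n})=\mathrm{E}\big[\sup_{h_{1:n}\in\mathcal{H}_{1:n}}\sum_{k=1}^nU_kh_k(Z_k)\big]$, where $U_{1:n}$ is a Rademacher sequence independent of $Z_{1:n}$. The usual conventions $\epsilon/0=\infty$, $\epsilon/\infty=0$, $\exp(-\infty)=0$ are used. *)

theory Defs
  imports "HOL-Probability.Probability"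
begin

(* Spaces S 1, ..., S n are topologies whose carriers live in a common type 'a.  They may be pairwise
   different; any finite list of Polish spaces can be presented this way (disjoint union as 'a). *)

definition Polish_space :: "'a topology \<Rightarrow> bool" where
  "Polish_space X \<longleftrightarrow> completely_metrizable_space X \<and> separable_space X"

definition borel_of :: "'a topology \<Rightarrow> 'a measure" where
  "borel_of X = sigma (topspace X) {U. openin X U}"

lemma space_borel_of [simp]: "space (borel_of X) = topspace X"
  by (simp add: borel_of_def space_measure_of_conv)

(* The product sigma-algebra; for Polish factors it is the Borel sigma-algebra of the product. *)
abbreviation prod_borel :: "nat \<Rightarrow> (nat \<Rightarrow> 'a topology) \<Rightarrow> (nat \<Rightarrow> 'a) measure" where
  "prod_borel n S \<equiv> PiM {1..n} (\<lambda>k. borel_of (S k))"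

(* A member h of the family has components h 1, ..., h n; the values of h k outside topspace (S k),
   and of h k for k outside {1..n}, are irrelevant. *)
definition sequential_family ::
    "nat \<Rightarrow> (nat \<Rightarrow> 'a topology) \<Rightarrow> (nat \<Rightarrow> 'a \<Rightarrow> real) set \<Rightarrow> bool" where
  "sequential_family n S H \<longleftrightarrow>
     H \<noteq> {} \<and> (\<forall>h\<in>H. \<forall>k\<in>{1..n}. h k \<in> borel_measurable (borel_of (S k)))"

definition pointwise_measurable ::
    "nat \<Rightarrow> (nat \<Rightarrow> 'a topology) \<Rightarrow> (nat \<Rightarrow> 'a \<Rightarrow> real) set \<Rightarrow> bool" where
  "pointwise_measurable n S H \<longleftrightarrow>
     (\<exists>g :: nat \<Rightarrow> nat \<Rightarrow> 'a \<Rightarrow> real. range g \<subseteq> H \<and>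
       (\<forall>h\<in>H. \<exists>l :: nat \<Rightarrow> nat. \<forall>z \<in> (\<Pi>\<^sub>E k\<in>{1..n}. topspace (S k)). \<forall>k\<in>{1..n}.
          (\<lambda>m. g (l m) k (z k)) \<longlonglongrightarrow> h k (z k)))"

(* Expectation in [-\<infinity>, \<infinity>].  It is meaningful when expectation_defined holds; otherwise
   the ereal convention \<infinity> - \<infinity> = \<infinity> applies. *)
definition ext_expectation :: "'w measure \<Rightarrow> ('w \<Rightarrow> ereal) \<Rightarrow> ereal" where
  "ext_expectation M f =
     enn2ereal (\<integral>\<^sup>+ \<omega>. e2ennreal (f \<omega>) \<partial>M) - enn2ereal (\<integral>\<^sup>+ \<omega>. e2ennreal (- f \<omega>) \<partial>M)"

definition expectation_defined :: "'w measure \<Rightarrow> ('w \<Rightarrow> ereal) \<Rightarrow> bool" where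
  "expectation_defined M f \<longleftrightarrow> f \<in> borel_measurable M \<and>
     ((\<integral>\<^sup>+ \<omega>. e2ennreal (f \<omega>) \<partial>M) < \<infinity> \<or> (\<integral>\<^sup>+ \<omega>. e2ennreal (- f \<omega>) \<partial>M) < \<infinity>)"

lemma ext_expectation_eq_integral:
  assumes "integrable M f"
  shows "ext_expectation M (\<lambda>\<omega>. ereal (f \<omega>)) = ereal (integral\<^sup>L M f)"
proof -
  have "(\<integral>\<^sup>+ \<omega>. ennreal (f \<omega>) \<partial>M) \<noteq> \<infinity>" "(\<integral>\<^sup>+ \<omega>. ennreal (- f \<omega>) \<partial>M) \<noteq> \<infinity>"
    using assms by (auto simp: real_integrable_def)
  then show ?thesis
    unfolding ext_expectation_def real_lebesgue_integral_def[OF assms]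
    by (cases "\<integral>\<^sup>+ \<omega>. ennreal (f \<omega>) \<partial>M"; cases "\<integral>\<^sup>+ \<omega>. ennreal (- f \<omega>) \<partial>M")
       (auto simp: enn2ereal_ennreal ennreal.rep_eq e2ennreal_ereal)
qed

(* Independence of two random elements with possibly different value types; indep_var requires
   the two value types to coincide. *)
definition indep_elements ::
    "'w measure \<Rightarrow> 'b measure \<Rightarrow> ('w \<Rightarrow> 'b) \<Rightarrow> 'c measure \<Rightarrow> ('w \<Rightarrow> 'c) \<Rightarrow> bool" where
  "indep_elements M N X L Y \<longleftrightarrow> X \<in> measurable M N \<and> Y \<in> measurable M L \<and>
     prob_space.indep_set M {X -` A \<inter> space M | A. A \<in> sets N} {Y -` B \<inter> space M | B. B \<in> sets L}"

definition independent_copy :: "'w measure \<Rightarrow> 'b measure \<Rightarrow> ('w \<Rightarrow> 'b) \<Rightarrow> ('w \<Rightarrow> 'b) \<Rightarrow> bool" where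
  "independent_copy M N X X' \<longleftrightarrow> indep_elements M N X N X' \<and> distr M N X' = distr M N X"

definition rademacher_sequence :: "'w measure \<Rightarrow> nat \<Rightarrow> ('w \<Rightarrow> nat \<Rightarrow> real) \<Rightarrow> bool" where
  "rademacher_sequence M n U \<longleftrightarrow>
     U \<in> measurable M (PiM {1..n} (\<lambda>_. borel)) \<and>
     prob_space.indep_vars M (\<lambda>_. borel) (\<lambda>k \<omega>. U \<omega> k) {1..n} \<and>
     (\<forall>k\<in>{1..n}. measure M {\<omega>\<in>space M. U \<omega> k = 1} = 1/2 \<and>
                  measure M {\<omega>\<in>space M. U \<omega> k = -1} = 1/2)"

(* To be used with U a Rademacher sequence independent of Z. *)
definition rademacher_complexity ::
    "'w measure \<Rightarrow> nat \<Rightarrow> ('w \<Rightarrow> nat \<Rightarrow> real) \<Rightarrow> (nat \<Rightarrow> 'a \<Rightarrow> real) set \<Rightarrow> ('w \<Rightarrow> nat \<Rightarrow> 'a) \<Rightarrow> ereal"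
  where
  "rademacher_complexity M n U H Z =
     ext_expectation M (\<lambda>\<omega>. SUP h\<in>H. ereal (\<Sum>k=1..n. U \<omega> k * h k (Z \<omega> k)))"

definition envelope :: "(nat \<Rightarrow> 'a \<Rightarrow> real) set \<Rightarrow> nat \<Rightarrow> 'a \<Rightarrow> ereal" where
  "envelope H k z = (SUP h\<in>H. ereal \<bar>h k z\<bar>)"

definition ext_sqrt :: "ereal \<Rightarrow> ereal" where
  "ext_sqrt x = (if \<bar>x\<bar> = \<infinity> then x else ereal (sqrt (real_of_ereal x)))"

definition ext_exp :: "ereal \<Rightarrow> ereal" where
  "ext_exp x = (if x = \<infinity> then \<infinity> else if x = -\<infinity> then 0 else ereal (exp (real_of_ereal x)))"

definition ext_norm2 :: "nat \<Rightarrow> (nat \<Rightarrow> ereal) \<Rightarrow> ereal" where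
  "ext_norm2 n a = ext_sqrt (\<Sum>k=1..n. \<bar>a k\<bar>\<^sup>2)"

definition ess_norm :: "'w measure \<Rightarrow> ('w \<Rightarrow> ereal) \<Rightarrow> ereal" where
  "ess_norm M f = esssup M (\<lambda>\<omega>. \<bar>f \<omega>\<bar>)"

lemma (in prob_space) ess_norm_eq_Inf:
  assumes "f \<in> borel_measurable M"
  shows "ess_norm M f = (INF z \<in> {z::real. prob {\<omega>\<in>space M. ereal z < \<bar>f \<omega>\<bar>} = 0}. ereal z)"
proof -
  define A where "A = (\<lambda>z::ereal. {\<omega>\<in>space M. z < \<bar>f \<omega>\<bar>})"
  have m: "A z \<in> events" for z
    using assms unfolding A_def by measurable
  have ess: "ess_norm M f = Inf {z. emeasure M (A z) = 0}"
    unfolding ess_norm_def A_def using assms by (subst esssup_eq) auto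
  show ?thesis
  proof (rule antisym)
    show "ess_norm M f \<le> (INF z \<in> {z::real. prob {\<omega>\<in>space M. ereal z < \<bar>f \<omega>\<bar>} = 0}. ereal z)"
      unfolding ess by (rule INF_greatest, rule Inf_lower) (simp add: emeasure_eq_measure A_def)
    show "(INF z \<in> {z::real. prob {\<omega>\<in>space M. ereal z < \<bar>f \<omega>\<bar>} = 0}. ereal z) \<le> ess_norm M f"
      unfolding ess
    proof (rule Inf_greatest)
      fix z assume "z \<in> {z. emeasure M (A z) = 0}"
      then have z: "prob (A z) = 0" by (simp add: emeasure_eq_measure)
      show "(INF z \<in> {z::real. prob {\<omega>\<in>space M. ereal z < \<bar>f \<omega>\<bar>} = 0}. ereal z) \<le> z"
      proof (cases z)
        case (real r)
        then show ?thesis using z by (auto intro!: INF_lower simp: A_def)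
      next
        case MInf
        then have "A z = space M" by (auto simp: A_def intro: less_le_trans[of _ 0])
        then show ?thesis using z prob_space by simp
      qed simp
    qed
  qed
qed

(* The sum over k of E[h_k(Z'_k) - g_k(Z'_k)] for fixed h and g.  With h replaced by the
   sample-dependent function hhat (Z \<omega>), this is the value at \<omega> of the sum of the conditional
   expectations given Z, because Z' is independent of Z. *)
definition mean_difference ::
    "'w measure \<Rightarrow> nat \<Rightarrow> ('w \<Rightarrow> nat \<Rightarrow> 'a) \<Rightarrow> (nat \<Rightarrow> 'a \<Rightarrow> real) \<Rightarrow> (nat \<Rightarrow> 'a \<Rightarrow> real) \<Rightarrow> ereal" where
  "mean_difference M n Z' h g =
     (\<Sum>k=1..n. ext_expectation M (\<lambda>\<omega>'. ereal (h k (Z' \<omega>' k) - g k (Z' \<omega>' k))))"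

(* No measurability of z \<mapsto> hhat z is assumed, so an event about mean_difference M n Z' (hhat (Z \<omega>)) g
   need not be in sets M.  Upper bounds on its probability are therefore stated for outer_measure_of,
   and "with probability at least p" means that the event contains a measurable set of probability
   at least p.  For measurable events both agree with the usual meaning (see the next two lemmas). *)
definition holds_with_prob_at_least :: "'w measure \<Rightarrow> real \<Rightarrow> ('w \<Rightarrow> bool) \<Rightarrow> bool" where
  "holds_with_prob_at_least M p Q \<longleftrightarrow> (\<exists>A\<in>sets M. p \<le> measure M A \<and> (\<forall>\<omega>\<in>A. Q \<omega>))"

lemma (in prob_space) holds_with_prob_at_least_iff:
  assumes "{\<omega>\<in>space M. Q \<omega>} \<in> events"
  shows "holds_with_prob_at_least M p Q \<longleftrightarrow> p \<le> prob {\<omega>\<in>space M. Q \<omega>}"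
proof
  assume "holds_with_prob_at_least M p Q"
  then obtain A where A: "A \<in> events" "p \<le> prob A" "\<forall>\<omega>\<in>A. Q \<omega>"
    by (auto simp: holds_with_prob_at_least_def)
  moreover have "A \<subseteq> {\<omega>\<in>space M. Q \<omega>}" using A sets.sets_into_space by blast
  ultimately show "p \<le> prob {\<omega>\<in>space M. Q \<omega>}"
    using finite_measure_mono[OF _ assms] by (meson order_trans)
qed (use assms in \<open>auto simp: holds_with_prob_at_least_def\<close>)

lemma (in prob_space) outer_measure_of_event:
  "A \<in> events \<Longrightarrow> enn2ereal (outer_measure_of M A) = ereal (prob A)"
  by (simp add: emeasure_eq_measure)

end

theory Submission
  imports Defs
begin

text \<open>
  Write \<open>m h\<close> for the sum of the expectations of the \<open>h k (Z k)\<close>. Since \<open>hhat\<close> minimizes the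
  empirical sum, and \<open>htilde\<close> is a competitor, the excess risk \<open>m hhat - m htilde\<close> is at most
  \<open>D + T\<close>. Here \<open>D\<close> is the supremum over the family of the sums of \<open>E h k (Z k) - h k (Z k)\<close>; it
  absorbs the dependence of \<open>hhat\<close> on the sample. \<open>T\<close> is the centred empirical sum of the single
  function \<open>htilde\<close>.

  Let \<open>c k\<close> be the essential supremum of the envelope \<open>H k (Z k)\<close>. Changing one coordinate of the
  sample moves \<open>D\<close> and \<open>T\<close> by at most \<open>2 * c k\<close>, so McDiarmid's inequality (\<open>McDiarmid\<close>) bounds each
  of the probabilities of \<open>D \<ge> E D + \<epsilon>\<close> and of \<open>T \<ge> \<epsilon>\<close> by an exponential in
  \<open>- \<epsilon>\<^sup>2 / (2 * (\<Sum>k. (c k)\<^sup>2))\<close>; the factor 2 of the final bound counts the two events. Symmetrization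
  (\<open>symmetrization\<close>, together with \<open>rademacher_average\<close>) gives that \<open>E D\<close> is at most twice the Rademacher
  complexity.

  These bounds contain the sum of the squares of the separate essential suprema, whereas the claim contains
  the essential supremum of the sum of squares. Independence makes them equal: with positive probability all
  envelopes are simultaneously close to their essential suprema
  (\<open>indep_sum_bound_imp_component_bounds\<close>).

  Two technical points. Pointwise measurability allows every supremum over the family to be taken over a
  countable subfamily, which makes it measurable. The envelope bounds hold only almost surely, and the
  functions are therefore truncated at \<open>c k\<close>, which changes nothing almost surely and makes all
  suprema finite and all oscillation bounds valid at every point. If the essential norm is infinite the
  bounds are trivial; if it is 0 the excess risk vanishes identically.
\<close>

section \<open>Suprema of bounded sequences of functions\<close>

lemma bdd_above_bounded_seq:
  fixes a :: "nat \<Rightarrow> real"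
  assumes "\<And>l. \<bar>a l\<bar> \<le> B"
  shows "bdd_above (range a)"
  using assms by (intro bdd_aboveI[of _ B]) (auto simp: abs_le_iff)

lemma abs_SUP_le:
  fixes a :: "nat \<Rightarrow> real"
  assumes "\<And>l. \<bar>a l\<bar> \<le> B"
  shows "\<bar>SUP l. a l\<bar> \<le> B"
proof (rule abs_leI)
  show "(SUP l. a l) \<le> B"
    using assms by (intro cSUP_least) (auto simp: abs_le_iff)
  have "- a 0 \<le> B" "a 0 \<le> (SUP l. a l)"
    using assms[of 0] bdd_above_bounded_seq[OF assms] by (auto intro: cSUP_upper)
  then show "- (SUP l. a l) \<le> B" by linarith
qed

lemma SUP_le_SUP_add:
  fixes a b :: "nat \<Rightarrow> real"
  assumes "\<And>l. \<bar>b l\<bar> \<le> B" "\<And>l. a l \<le> b l + d"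
  shows "(SUP l. a l) \<le> (SUP l. b l) + d"
proof (rule cSUP_least)
  fix l
  have "b l \<le> (SUP l. b l)"
    using bdd_above_bounded_seq[OF assms(1)] by (auto intro: cSUP_upper)
  then show "a l \<le> (SUP l. b l) + d" using assms(2)[of l] by linarith
qed simp

lemma measurable_SUP_bounded:
  fixes F :: "nat \<Rightarrow> 'b \<Rightarrow> real"
  assumes "\<And>l. F l \<in> borel_measurable N" "\<And>l x. x \<in> space N \<Longrightarrow> \<bar>F l x\<bar> \<le> B"
  shows "(\<lambda>x. SUP l. F l x) \<in> borel_measurable N"
  using assms by (intro borel_measurable_cSUP) (auto intro!: bdd_above_bounded_seq)

lemma (in prob_space) integrable_bounded:
  fixes f :: "'a \<Rightarrow> real"
  assumes "f \<in> borel_measurable M" "\<And>x. x \<in> space M \<Longrightarrow> \<bar>f x\<bar> \<le> B"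
  shows "integrable M f"
  using assms by (intro integrable_const_bound[of _ B]) auto

lemma (in prob_space) integrable_SUP_bounded:
  fixes F :: "nat \<Rightarrow> 'a \<Rightarrow> real"
  assumes "\<And>l. F l \<in> borel_measurable M" "\<And>l x. x \<in> space M \<Longrightarrow> \<bar>F l x\<bar> \<le> B"
  shows "integrable M (\<lambda>x. SUP l. F l x)"
  by (intro integrable_bounded[of _ B] measurable_SUP_bounded[of _ _ B] abs_SUP_le assms)

lemma (in prob_space) abs_expectation_le:
  fixes f :: "'a \<Rightarrow> real"
  assumes "f \<in> borel_measurable M" "\<And>x. x \<in> space M \<Longrightarrow> \<bar>f x\<bar> \<le> B"
  shows "\<bar>expectation f\<bar> \<le> B"
proof -
  have "expectation f \<le> B" using assms 
    by (intro integral_le_const integrable_bounded) (auto simp: abs_le_iff)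
  moreover have "- B \<le> expectation f" using assms
    by (intro integral_ge_const integrable_bounded AE_I2) (fastforce simp: abs_le_iff)+
  ultimately show ?thesis by (simp add: abs_le_iff)
qed

section \<open>McDiarmid's inequality\<close>

text \<open>Hoeffding's lemma with the range of the variable described by its oscillation: the interval of length
\<open>c\<close> starts at the infimum of \<open>f\<close>. This is the form that a bounded-difference hypothesis supplies.\<close>

lemma (in prob_space) Hoeffding_oscillation:
  fixes f :: "'a \<Rightarrow> real"
  assumes "f \<in> borel_measurable M" "0 < l"
    and osc: "\<And>x y. x \<in> space M \<Longrightarrow> y \<in> space M \<Longrightarrow> f x - f y \<le> c"
  shows "expectation (\<lambda>x. exp (l * (f x - expectation f))) \<le> exp (l\<^sup>2 * c\<^sup>2 / 8)"
proof -
  obtain x0 where x0: "x0 \<in> space M" using not_empty by blast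
  define a where "a = (INF x\<in>space M. f x)"
  have bdd: "bdd_below (f ` space M)"
    using osc[OF x0] by (intro bdd_belowI2[of _ "f x0 - c"]) (auto simp: algebra_simps)
  have lo: "a \<le> f x" if "x \<in> space M" for x
    unfolding a_def using bdd that by (rule cINF_lower)
  have hi: "f x \<le> a + c" if "x \<in> space M" for x
  proof -
    have "f x - c \<le> a" unfolding a_def using osc[OF that] not_empty
      by (intro cINF_greatest) (auto simp: algebra_simps)
    then show ?thesis by linarith
  qed
  interpret interval_bounded_random_variable M f a "a + c"
    by unfold_locales (use assms lo hi in auto)
  have int: "integrable M (\<lambda>x. exp (l * (f x - expectation f)))"
  proof (rule integrable_bounded)
    fix x assume "x \<in> space M"
    then show "\<bar>exp (l * (f x - expectation f))\<bar> \<le> exp (l * (a + c - expectation f))"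
      using hi assms(2) by auto
  qed (use assms(1) in measurable)
  have "ennreal (expectation (\<lambda>x. exp (l * (f x - expectation f)))) =
      (\<integral>\<^sup>+x. exp (l * (f x - expectation f)) \<partial>M)"
    by (intro nn_integral_eq_integral[symmetric] int) auto
  also have "\<dots> \<le> ennreal (exp (l\<^sup>2 * c\<^sup>2 / 8))"
    using Hoeffdings_lemma_nn_integral[OF assms(2)] by simp
  finally show ?thesis by (simp add: ennreal_le_iff)
qed

lemma integral_PiM_insert:
  fixes f :: "('i \<Rightarrow> 'a) \<Rightarrow> real"
  assumes P: "\<And>i. prob_space (P i)" and "finite I" "i \<notin> I"
    and "integrable (PiM (insert i I) P) f"
  shows "integral\<^sup>L (PiM (insert i I) P) f = (\<integral>y. (\<integral>x. f (y(i := x)) \<partial>P i) \<partial>PiM I P)"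
proof -
  interpret product_sigma_finite P
    by (simp add: product_sigma_finite_def P prob_space_imp_sigma_finite)
  show ?thesis using product_integral_insert assms by blast
qed

lemma measurable_PiM_upd:
  assumes f: "f \<in> borel_measurable (PiM (insert i I) P)"
  shows "(\<lambda>(y, x). f (y(i := x))) \<in> borel_measurable (PiM I P \<Otimes>\<^sub>M P i)"
proof -
  have "(\<lambda>p. (fst p)(i := snd p)) \<in> measurable (PiM I P \<Otimes>\<^sub>M P i) (PiM (insert i I) P)"
    by (rule measurable_fun_upd[where J=I]) auto
  from measurable_compose[OF this f] show ?thesis by (simp add: case_prod_unfold)
qed

lemma space_PiM_upd:
  "y \<in> space (PiM I P) \<Longrightarrow> x \<in> space (P i) \<Longrightarrow> y(i := x) \<in> space (PiM (insert i I) P)"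
  by (auto simp: space_PiM PiE_def extensional_def)

lemma measurable_PiM_component:
  "k \<in> I \<Longrightarrow> f \<in> measurable (P k) N \<Longrightarrow> (\<lambda>z. f (z k)) \<in> measurable (PiM I P) N"
  by (rule measurable_compose[OF measurable_component_singleton])

text \<open>Induction on the index set. Integrating out the coordinate \<open>i\<close> leaves a function \<open>g\<close> of the others that has
the same bounds on its differences and the same mean. The exponential then factors into one of \<open>g\<close> minus the
mean and one of \<open>f - g\<close>. For fixed other coordinates, Hoeffding's lemma bounds the integral of the second
factor by the contribution of \<open>c i\<close>.\<close>

lemma McDiarmid_mgf:
  fixes f :: "('i \<Rightarrow> 'a) \<Rightarrow> real" and c :: "'i \<Rightarrow> real"
  assumes P: "\<And>i. prob_space (P i)" and "finite I" and l: "0 < l"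
    and "f \<in> borel_measurable (PiM I P)"
    and "\<And>z. z \<in> space (PiM I P) \<Longrightarrow> \<bar>f z\<bar> \<le> B"
    and "\<And>z i x. z \<in> space (PiM I P) \<Longrightarrow> i \<in> I \<Longrightarrow> x \<in> space (P i) \<Longrightarrow> f (z(i := x)) - f z \<le> c i"
  shows "(\<integral>z. exp (l * (f z - integral\<^sup>L (PiM I P) f)) \<partial>PiM I P) \<le> exp (l\<^sup>2 * (\<Sum>i\<in>I. (c i)\<^sup>2) / 8)"
  using assms(2,4-)
proof (induction I arbitrary: f rule: finite_induct)
  case empty
  interpret prob_space "PiM {} P" by (intro prob_space_PiM P)
  show ?case by (simp add: PiM_empty lebesgue_integral_count_space_finite)
next
  case (insert i I)
  interpret Pi: prob_space "P i" by (rule P)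
  interpret N: prob_space "PiM I P" by (intro prob_space_PiM P)
  interpret N': prob_space "PiM (insert i I) P" by (intro prob_space_PiM P)
  note f = insert.prems
  note [measurable] = f(1)
  have fupd[measurable]: "(\<lambda>(y, x). f (y(i := x))) \<in> borel_measurable (PiM I P \<Otimes>\<^sub>M P i)"
    by (rule measurable_PiM_upd[OF f(1)])
  have fx: "(\<lambda>x. f (y(i := x))) \<in> borel_measurable (P i)" if "y \<in> space (PiM I P)" for y
    using measurable_compose[OF measurable_Pair1'[OF that] fupd] by simp
  have fy: "(\<lambda>y. f (y(i := x))) \<in> borel_measurable (PiM I P)" if "x \<in> space (P i)" for x
    using measurable_compose[OF measurable_Pair2'[OF that] fupd] by simp
  define g where "g y = (\<integral>x. f (y(i := x)) \<partial>P i)" for y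
  have g_meas[measurable]: "g \<in> borel_measurable (PiM I P)"
    unfolding g_def by (rule Pi.borel_measurable_lebesgue_integral) (rule fupd)
  have fB: "\<bar>f (y(i := x))\<bar> \<le> B" if "y \<in> space (PiM I P)" "x \<in> space (P i)" for x y
    using f(2) space_PiM_upd[OF that] by blast
  have gB: "\<bar>g y\<bar> \<le> B" if "y \<in> space (PiM I P)" for y
    unfolding g_def by (intro Pi.abs_expectation_le fx fB that)
  have fint: "integrable (P i) (\<lambda>x. f (y(i := x)))" if "y \<in> space (PiM I P)" for y
    by (rule Pi.integrable_bounded[OF fx[OF that] fB[OF that]])
  have gosc: "g (y(j := x)) - g y \<le> c j"
    if y: "y \<in> space (PiM I P)" and j: "j \<in> I" and x: "x \<in> space (P j)" for y j x
  proof -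
    have y': "y(j := x) \<in> space (PiM I P)" using space_PiM_upd[OF y x] j by (simp add: insert_absorb)
    have "i \<noteq> j" using j insert by auto
    have "g (y(j := x)) - g y = (\<integral>t. f (y(j := x, i := t)) - f (y(i := t)) \<partial>P i)"
      unfolding g_def by (subst Bochner_Integration.integral_diff) (use fint y y' in auto)
    also have "\<dots> \<le> c j"
    proof (rule Pi.integral_le_const)
      show "AE t in P i. f (y(j := x, i := t)) - f (y(i := t)) \<le> c j"
      proof (rule AE_I2)
        fix t assume "t \<in> space (P i)"
        then have "f (y(i := t, j := x)) - f (y(i := t)) \<le> c j"
          using j x by (intro f(3) space_PiM_upd y) auto
        then show "f (y(j := x, i := t)) - f (y(i := t)) \<le> c j"
          by (metis fun_upd_twist \<open>i \<noteq> j\<close>)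
      qed
    qed (use fint y y' in auto)
    finally show ?thesis .
  qed
  have IH: "(\<integral>y. exp (l * (g y - integral\<^sup>L (PiM I P) g)) \<partial>PiM I P) \<le> exp (l\<^sup>2 * (\<Sum>i\<in>I. (c i)\<^sup>2) / 8)"
    by (intro insert.IH g_meas gB gosc)
  define m where "m = integral\<^sup>L (PiM I P) g"
  have m: "integral\<^sup>L (PiM (insert i I) P) f = m"
    unfolding m_def g_def using insert f
    by (intro integral_PiM_insert P N'.integrable_bounded[of _ B]) auto
  have mB: "\<bar>m\<bar> \<le> B" unfolding m_def by (intro N.abs_expectation_le g_meas gB)
  have expB: "\<bar>exp (l * (t - m))\<bar> \<le> exp (l * (2 * B))" if "\<bar>t\<bar> \<le> B" for t
    using that mB l by auto
  have "(\<integral>z. exp (l * (f z - m)) \<partial>PiM (insert i I) P) =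
      (\<integral>y. (\<integral>x. exp (l * (f (y(i := x)) - m)) \<partial>P i) \<partial>PiM I P)"
    by (intro integral_PiM_insert P insert.hyps N'.integrable_bounded[OF _ expB] f) measurable
  also have "\<dots> \<le> (\<integral>y. exp (l * (g y - m)) * exp (l\<^sup>2 * (c i)\<^sup>2 / 8) \<partial>PiM I P)"
  proof (rule integral_mono)
    show "integrable (PiM I P) (\<lambda>y. (\<integral>x. exp (l * (f (y(i := x)) - m)) \<partial>P i))"
    proof (rule N.integrable_bounded)
      show "(\<lambda>y. (\<integral>x. exp (l * (f (y(i := x)) - m)) \<partial>P i)) \<in> borel_measurable (PiM I P)"
        by (rule Pi.borel_measurable_lebesgue_integral) (use fupd in measurable)
      show "\<bar>\<integral>x. exp (l * (f (y(i := x)) - m)) \<partial>P i\<bar> \<le> exp (l * (2 * B))"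
        if "y \<in> space (PiM I P)" for y
        by (intro Pi.abs_expectation_le expB fB that) (use fx[OF that] in measurable)
    qed
    show "integrable (PiM I P) (\<lambda>y. exp (l * (g y - m)) * exp (l\<^sup>2 * (c i)\<^sup>2 / 8))"
      by (intro integrable_mult_left N.integrable_bounded[OF _ expB] gB) measurable
    fix y assume y: "y \<in> space (PiM I P)"
    have "(\<integral>x. exp (l * (f (y(i := x)) - m)) \<partial>P i) =
        (\<integral>x. exp (l * (g y - m)) * exp (l * (f (y(i := x)) - g y)) \<partial>P i)"
      by (simp add: exp_add[symmetric] algebra_simps)
    also have "\<dots> = exp (l * (g y - m)) * (\<integral>x. exp (l * (f (y(i := x)) - g y)) \<partial>P i)"
      by simp
    also have "\<dots> \<le> exp (l * (g y - m)) * exp (l\<^sup>2 * (c i)\<^sup>2 / 8)"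
    proof (rule mult_left_mono)
      show "(\<integral>x. exp (l * (f (y(i := x)) - g y)) \<partial>P i) \<le> exp (l\<^sup>2 * (c i)\<^sup>2 / 8)"
        unfolding g_def
      proof (rule Pi.Hoeffding_oscillation[OF fx[OF y] l])
        fix x x' assume "x \<in> space (P i)" "x' \<in> space (P i)"
        then have "f (y(i := x', i := x)) - f (y(i := x')) \<le> c i"
          by (intro f(3) space_PiM_upd y) auto
        then show "f (y(i := x)) - f (y(i := x')) \<le> c i" by simp
      qed
    qed simp
    finally show "(\<integral>x. exp (l * (f (y(i := x)) - m)) \<partial>P i) \<le> exp (l * (g y - m)) * exp (l\<^sup>2 * (c i)\<^sup>2 / 8)" .
  qed
  also have "\<dots> = (\<integral>y. exp (l * (g y - m)) \<partial>PiM I P) * exp (l\<^sup>2 * (c i)\<^sup>2 / 8)"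
    by simp
  also have "\<dots> \<le> exp (l\<^sup>2 * (\<Sum>i\<in>I. (c i)\<^sup>2) / 8) * exp (l\<^sup>2 * (c i)\<^sup>2 / 8)"
    using IH by (intro mult_right_mono) (auto simp: m_def)
  also have "\<dots> = exp (l\<^sup>2 * (\<Sum>i\<in>insert i I. (c i)\<^sup>2) / 8)"
    using insert.hyps by (simp add: exp_add[symmetric] field_simps)
  finally show ?case unfolding m .
qed

text \<open>The bound \<open>v\<close> replaces the sum of squares in order that \<open>v > 0\<close> can be demanded even when all the \<open>c i\<close>
vanish.\<close>

theorem McDiarmid:
  fixes f :: "('i \<Rightarrow> 'a) \<Rightarrow> real" and c :: "'i \<Rightarrow> real"
  assumes P: "\<And>i. prob_space (P i)" and "finite I"
    and f: "f \<in> borel_measurable (PiM I P)" "\<And>z. z \<in> space (PiM I P) \<Longrightarrow> \<bar>f z\<bar> \<le> B"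
    and osc: "\<And>z i x. z \<in> space (PiM I P) \<Longrightarrow> i \<in> I \<Longrightarrow> x \<in> space (P i) \<Longrightarrow> f (z(i := x)) - f z \<le> c i"
    and t: "0 < t" and v: "(\<Sum>i\<in>I. (c i)\<^sup>2) \<le> v" "0 < v"
  shows "measure (PiM I P) {z \<in> space (PiM I P). t \<le> f z - integral\<^sup>L (PiM I P) f} \<le> exp (- 2 * t\<^sup>2 / v)"
proof -
  interpret N: prob_space "PiM I P" by (intro prob_space_PiM P)
  define m where "m = integral\<^sup>L (PiM I P) f"
  \<comment> \<open>the minimizer of \<open>l\<^sup>2 * v / 8 - l * t\<close>\<close>
  define l where "l = 4 * t / v"
  have l: "0 < l" unfolding l_def using t v by simp
  have mB: "\<bar>m\<bar> \<le> B" unfolding m_def by (intro N.abs_expectation_le f)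
  have "N.prob {z \<in> space (PiM I P). exp (l * t) \<le> exp (l * (f z - m))}
      \<le> (\<integral>z. exp (l * (f z - m)) \<partial>PiM I P) / exp (l * t)"
  proof (rule integral_Markov_inequality_measure[where A = "{}"])
    show "integrable (PiM I P) (\<lambda>z. exp (l * (f z - m)))"
    proof (rule N.integrable_bounded)
      show "\<bar>exp (l * (f z - m))\<bar> \<le> exp (l * (2 * B))" if "z \<in> space (PiM I P)" for z
        using f(2)[OF that] mB l by auto
    qed (use f in measurable)
  qed auto
  also have "\<dots> \<le> exp (l\<^sup>2 * v / 8) / exp (l * t)"
  proof (rule divide_right_mono)
    have "(\<integral>z. exp (l * (f z - m)) \<partial>PiM I P) \<le> exp (l\<^sup>2 * (\<Sum>i\<in>I. (c i)\<^sup>2) / 8)"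
      unfolding m_def by (rule McDiarmid_mgf[OF P \<open>finite I\<close> l f osc])
    also have "\<dots> \<le> exp (l\<^sup>2 * v / 8)"
      using v by (simp add: mult_left_mono)
    finally show "(\<integral>z. exp (l * (f z - m)) \<partial>PiM I P) \<le> exp (l\<^sup>2 * v / 8)" .
  qed simp
  also have "\<dots> = exp (- 2 * t\<^sup>2 / v)"
    unfolding exp_diff[symmetric] l_def using v by (simp add: power2_eq_square field_simps)
  finally show ?thesis using l by (simp add: m_def)
qed


section \<open>Symmetrization\<close>

text \<open>The supremum is convex and \<open>b + (\<mu> - g)\<close> is the midpoint of \<open>b + 2 * \<mu>\<close> and \<open>b - 2 * g\<close>, where \<open>\<mu>\<close> is the
mean of \<open>g\<close>; Jensen's inequality replaces \<open>\<mu>\<close> by \<open>g\<close> in the first. In this form a random sign on a single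
coordinate is created without a second, independent copy of the sample.\<close>

lemma (in prob_space) symmetrization_step:
  fixes b :: "nat \<Rightarrow> real" and g :: "nat \<Rightarrow> 'a \<Rightarrow> real"
  assumes b: "\<And>l. \<bar>b l\<bar> \<le> B"
    and g: "\<And>l. g l \<in> borel_measurable M" "\<And>l x. \<bar>g l x\<bar> \<le> C"
  shows "expectation (\<lambda>x. SUP l. b l + (expectation (g l) - g l x))
    \<le> (expectation (\<lambda>x. SUP l. b l + 2 * g l x) + expectation (\<lambda>x. SUP l. b l - 2 * g l x)) / 2"
proof -
  define S where "S = (SUP l. b l + 2 * expectation (g l))"
  have \<mu>: "\<bar>expectation (g l)\<bar> \<le> C" for l by (intro abs_expectation_le g)
  have bound: "\<bar>b l + u\<bar> \<le> B + 2 * C" if "\<bar>u\<bar> \<le> 2 * C" for l u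
    using b[of l] that by linarith
  have plus: "\<bar>b l + 2 * g l x\<bar> \<le> B + 2 * C" for l x
    using g(2)[of l x] by (intro bound) auto
  have minus: "\<bar>b l - 2 * g l x\<bar> \<le> B + 2 * C" for l x
    using bound[of "- 2 * g l x" l] g(2)[of l x] by auto
  have mid: "\<bar>b l + (expectation (g l) - g l x)\<bar> \<le> B + 2 * C" for l x
    using g(2)[of l x] \<mu>[of l] by (intro bound) linarith
  have mean: "\<bar>b l + 2 * expectation (g l)\<bar> \<le> B + 2 * C" for l
    using \<mu>[of l] by (intro bound) auto
  have intp: "integrable M (\<lambda>x. SUP l. b l + 2 * g l x)"
    by (rule integrable_SUP_bounded[OF _ plus]) (use g(1) in measurable)
  have intm: "integrable M (\<lambda>x. SUP l. b l - 2 * g l x)"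
    by (rule integrable_SUP_bounded[OF _ minus]) (use g(1) in measurable)
  have int0: "integrable M (\<lambda>x. SUP l. b l + (expectation (g l) - g l x))"
    by (rule integrable_SUP_bounded[OF _ mid]) (use g(1) in measurable)
  have S: "S \<le> expectation (\<lambda>x. SUP l. b l + 2 * g l x)"
    unfolding S_def
  proof (rule cSUP_least)
    fix l
    have "b l + 2 * expectation (g l) = expectation (\<lambda>x. b l + 2 * g l x)"
      using integrable_bounded[OF g] by (simp add: prob_space)
    also have "\<dots> \<le> expectation (\<lambda>x. SUP l. b l + 2 * g l x)"
    proof (rule integral_mono[OF _ intp])
      show "integrable M (\<lambda>x. b l + 2 * g l x)"
        using integrable_bounded[OF g] by simp
      show "b l + 2 * g l x \<le> (SUP l. b l + 2 * g l x)" for x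
        using bdd_above_bounded_seq[OF plus] by (intro cSUP_upper) auto
    qed
    finally show "b l + 2 * expectation (g l) \<le> expectation (\<lambda>x. SUP l. b l + 2 * g l x)" .
  qed simp
  have "expectation (\<lambda>x. SUP l. b l + (expectation (g l) - g l x))
      \<le> expectation (\<lambda>x. (S + (SUP l. b l - 2 * g l x)) / 2)"
  proof (rule integral_mono[OF int0])
    show "integrable M (\<lambda>x. (S + (SUP l. b l - 2 * g l x)) / 2)" using intm by simp
    fix x
    have aux: "\<beta> + (e - y) \<le> (s + r) / 2" if "\<beta> + 2 * e \<le> s" "\<beta> - 2 * y \<le> r" for \<beta> e y s r :: real
      using that by (simp add: field_simps)
    show "(SUP l. b l + (expectation (g l) - g l x)) \<le> (S + (SUP l. b l - 2 * g l x)) / 2"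
    proof (rule cSUP_least)
      fix l
      have "b l + 2 * expectation (g l) \<le> S" unfolding S_def
        using bdd_above_bounded_seq[OF mean] by (intro cSUP_upper) auto
      moreover have "b l - 2 * g l x \<le> (SUP l. b l - 2 * g l x)"
        using bdd_above_bounded_seq[OF minus] by (intro cSUP_upper) auto
      ultimately show "b l + (expectation (g l) - g l x) \<le> (S + (SUP l. b l - 2 * g l x)) / 2"
        by (rule aux)
    qed simp
  qed
  also have "\<dots> = (S + expectation (\<lambda>x. SUP l. b l - 2 * g l x)) / 2"
    using intm by (simp add: prob_space)
  also have "\<dots> \<le> (expectation (\<lambda>x. SUP l. b l + 2 * g l x) + expectation (\<lambda>x. SUP l. b l - 2 * g l x)) / 2"
    by (intro divide_right_mono add_right_mono S) simp
  finally show ?thesis .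
qed

lemma symmetrization_coordinate:
  fixes b :: "nat \<Rightarrow> ('i \<Rightarrow> 'a) \<Rightarrow> real" and g :: "nat \<Rightarrow> 'a \<Rightarrow> real"
  assumes P: "\<And>i. prob_space (P i)" and "finite I" "i \<in> I"
    and b: "\<And>l. b l \<in> borel_measurable (PiM I P)" "\<And>l z. \<bar>b l z\<bar> \<le> B"
    and ind: "\<And>l z x. b l (z(i := x)) = b l z"
    and g: "\<And>l. g l \<in> borel_measurable (P i)" "\<And>l x. \<bar>g l x\<bar> \<le> C"
  shows "(\<integral>z. (SUP l. b l z + (integral\<^sup>L (P i) (g l) - g l (z i))) \<partial>PiM I P)
    \<le> ((\<integral>z. (SUP l. b l z + 2 * g l (z i)) \<partial>PiM I P) + (\<integral>z. (SUP l. b l z - 2 * g l (z i)) \<partial>PiM I P)) / 2"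
    (is "integral\<^sup>L _ ?F \<le> (integral\<^sup>L _ ?F1 + integral\<^sup>L _ ?F2) / 2")
proof -
  interpret Pi: prob_space "P i" by (rule P)
  interpret N: prob_space "PiM I P" by (intro prob_space_PiM P)
  have [measurable]: "(\<lambda>z. g l (z i)) \<in> borel_measurable (PiM I P)" for l
    by (rule measurable_PiM_component[where f = "g l", OF \<open>i \<in> I\<close>]) (rule g(1))
  note b(1)[measurable] g(1)[measurable]
  have \<mu>: "\<bar>integral\<^sup>L (P i) (g l)\<bar> \<le> C" for l by (intro Pi.abs_expectation_le g)
  have bound: "\<bar>b l z + u\<bar> \<le> B + 2 * C" if "\<bar>u\<bar> \<le> 2 * C" for l z u
    using b(2)[of l z] that by linarith
  have plus: "\<bar>b l z + 2 * g l x\<bar> \<le> B + 2 * C" for l z x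
    using g(2)[of l x] by (intro bound) auto
  have minus: "\<bar>b l z - 2 * g l x\<bar> \<le> B + 2 * C" for l z x
    using bound[of "- 2 * g l x" l] g(2)[of l x] by auto
  have mid: "\<bar>b l z + (integral\<^sup>L (P i) (g l) - g l x)\<bar> \<le> B + 2 * C" for l z x
    using g(2)[of l x] \<mu>[of l] by (intro bound) linarith
  have int1: "integrable (PiM I P) ?F1" by (rule N.integrable_SUP_bounded[OF _ plus]) measurable
  have int2: "integrable (PiM I P) ?F2" by (rule N.integrable_SUP_bounded[OF _ minus]) measurable
  have int0: "integrable (PiM I P) ?F" by (rule N.integrable_SUP_bounded[OF _ mid]) measurable
  define J where "J = I - {i}"
  have J: "finite J" "i \<notin> J" "I = insert i J" using assms(2,3) by (auto simp: J_def)
  obtain x0 where "x0 \<in> space (P i)" using Pi.not_empty by blast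
  let ?G = "\<lambda>z. (?F1 z + ?F2 z) / 2 - ?F z"
  have "0 \<le> (\<integral>y. (\<integral>x. ?G (y(i := x)) \<partial>P i) \<partial>PiM J P)"
  proof (rule Bochner_Integration.integral_nonneg)
    fix y
    have F1: "integrable (P i) (\<lambda>x. SUP l. b l y + 2 * g l x)"
      by (rule Pi.integrable_SUP_bounded[OF _ plus]) measurable
    have F2: "integrable (P i) (\<lambda>x. SUP l. b l y - 2 * g l x)"
      by (rule Pi.integrable_SUP_bounded[OF _ minus]) measurable
    have F0: "integrable (P i) (\<lambda>x. SUP l. b l y + (integral\<^sup>L (P i) (g l) - g l x))"
      by (rule Pi.integrable_SUP_bounded[OF _ mid]) measurable
    have "(\<integral>x. ?G (y(i := x)) \<partial>P i) =
      ((\<integral>x. (SUP l. b l y + 2 * g l x) \<partial>P i) + (\<integral>x. (SUP l. b l y - 2 * g l x) \<partial>P i)) / 2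
      - (\<integral>x. (SUP l. b l y + (integral\<^sup>L (P i) (g l) - g l x)) \<partial>P i)"
      using F1 F2 F0 by (simp add: ind)
    also have "\<dots> \<ge> 0"
      using Pi.symmetrization_step[where b = "\<lambda>l. b l y", OF b(2) g] by simp
    finally show "0 \<le> (\<integral>x. ?G (y(i := x)) \<partial>P i)" .
  qed
  also have "\<dots> = integral\<^sup>L (PiM I P) ?G"
    using int1 int2 int0 unfolding J(3)
    by (intro integral_PiM_insert[symmetric] P J(1,2)) simp
  also have "\<dots> = (integral\<^sup>L (PiM I P) ?F1 + integral\<^sup>L (PiM I P) ?F2) / 2 - integral\<^sup>L (PiM I P) ?F"
    using int1 int2 int0 by simp
  finally show ?thesis by simp
qed

definition sign_vector :: "'i set \<Rightarrow> 'i \<Rightarrow> real" where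
  "sign_vector J k = (if k \<in> J then 1 else - 1)"

lemma sum_Pow_insert:
  assumes "finite A" "i \<notin> A"
  shows "(\<Sum>J\<in>Pow (insert i A). f J) = (\<Sum>J\<in>Pow A. f (insert i J) + f J :: real)"
proof -
  have "(\<Sum>J\<in>Pow (insert i A). f J) = (\<Sum>J\<in>Pow A. f J) + (\<Sum>J\<in>insert i ` Pow A. f J)"
    unfolding Pow_insert using assms by (intro sum.union_disjoint) auto
  also have "(\<Sum>J\<in>insert i ` Pow A. f J) = (\<Sum>J\<in>Pow A. f (insert i J))"
    using assms by (subst sum.reindex) (auto simp: inj_on_def)
  finally show ?thesis by (simp add: sum.distrib)
qed

text \<open>The coordinates are symmetrized one after the other. Those in \<open>A\<close> already carry a sign, and the average runs
over the sign patterns on \<open>A\<close>; each further coordinate splits every pattern into two. The measure stays the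
full product throughout, so that a step needs Fubini's theorem for one coordinate only.\<close>

lemma symmetrization_partial:
  fixes g :: "nat \<Rightarrow> 'i \<Rightarrow> 'a \<Rightarrow> real" and c :: "'i \<Rightarrow> real"
  assumes P: "\<And>i. prob_space (P i)" and I: "finite I" and "A \<subseteq> I"
    and g: "\<And>l k. k \<in> I \<Longrightarrow> g l k \<in> borel_measurable (P k)" "\<And>l k x. \<bar>g l k x\<bar> \<le> c k"
  defines "F \<equiv> \<lambda>A J z. SUP l. \<Sum>k\<in>I. if k \<in> A then 2 * sign_vector J k * g l k (z k)
                                          else integral\<^sup>L (P k) (g l k) - g l k (z k)"
  shows "(\<integral>z. F {} {} z \<partial>PiM I P) \<le> (\<Sum>J\<in>Pow A. \<integral>z. F A J z \<partial>PiM I P) / 2 ^ card A"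
  using finite_subset[OF \<open>A \<subseteq> I\<close> I] \<open>A \<subseteq> I\<close>
proof (induction A rule: finite_induct)
  case empty
  show ?case by simp
next
  case (insert i A)
  have c0: "0 \<le> c k" for k using g(2)[of 0 k undefined] by linarith
  have \<mu>: "\<bar>integral\<^sup>L (P k) (g l k)\<bar> \<le> c k" if "k \<in> I" for l k
    by (intro prob_space.abs_expectation_le P g that)
  have step: "(\<integral>z. F A J z \<partial>PiM I P) \<le>
      ((\<integral>z. F (insert i A) (insert i J) z \<partial>PiM I P) + (\<integral>z. F (insert i A) J z \<partial>PiM I P)) / 2"
    if J: "J \<subseteq> A" for J
  proof -
    define b where "b l z = (\<Sum>k\<in>I - {i}. if k \<in> A then 2 * sign_vector J k * g l k (z k)
        else integral\<^sup>L (P k) (g l k) - g l k (z k))" for l z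
    have i: "i \<notin> J" "i \<notin> A" "i \<in> I" using insert J by auto
    have rest: "(\<Sum>k\<in>I - {i}. if k \<in> insert i A then 2 * sign_vector J' k * g l k (z k)
        else integral\<^sup>L (P k) (g l k) - g l k (z k)) = b l z" if "J' \<in> {J, insert i J}" for J' l z
      unfolding b_def using that by (intro sum.cong) (auto simp: sign_vector_def)
    have split: "F A J = (\<lambda>z. SUP l. b l z + (integral\<^sup>L (P i) (g l i) - g l i (z i)))"
      "F (insert i A) (insert i J) = (\<lambda>z. SUP l. b l z + 2 * g l i (z i))"
      "F (insert i A) J = (\<lambda>z. SUP l. b l z - 2 * g l i (z i))"
      unfolding F_def sum.remove[OF I \<open>i \<in> I\<close>] b_def[symmetric]
        rest[of J, OF insertI1] rest[of "insert i J", OF insertI2[OF insertI1]]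
      using i by (simp_all add: sign_vector_def[of _ i] add.commute)
    show ?thesis unfolding split
    proof (rule symmetrization_coordinate[OF P I \<open>i \<in> I\<close>])
      show "b l \<in> borel_measurable (PiM I P)" for l
        unfolding b_def
      proof (intro borel_measurable_sum)
        fix k assume k: "k \<in> I - {i}"
        then have "(\<lambda>z. g l k (z k)) \<in> borel_measurable (PiM I P)"
          by (intro measurable_PiM_component[where f = "g l k"] g(1)) auto
        then show "(\<lambda>z. if k \<in> A then 2 * sign_vector J k * g l k (z k)
          else integral\<^sup>L (P k) (g l k) - g l k (z k)) \<in> borel_measurable (PiM I P)"
          by auto
      qed
      show "\<bar>b l z\<bar> \<le> (\<Sum>k\<in>I - {i}. 2 * c k)" for l z
        unfolding b_def
      proof (rule order_trans[OF sum_abs], rule sum_mono)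
        fix k assume "k \<in> I - {i}"
        then show "\<bar>if k \<in> A then 2 * sign_vector J k * g l k (z k)
          else integral\<^sup>L (P k) (g l k) - g l k (z k)\<bar> \<le> 2 * c k"
          using \<mu>[of k l] g(2)[of l k "z k"] by (auto simp: sign_vector_def)
      qed
      show "b l (z(i := x)) = b l z" for l z x
        unfolding b_def by (intro sum.cong) auto
      show "g l i \<in> borel_measurable (P i)" for l by (rule g(1)[OF \<open>i \<in> I\<close>])
      show "\<bar>g l i x\<bar> \<le> c i" for l x by (rule g(2))
    qed
  qed
  have "(\<integral>z. F {} {} z \<partial>PiM I P) \<le> (\<Sum>J\<in>Pow A. \<integral>z. F A J z \<partial>PiM I P) / 2 ^ card A"
    using insert by auto
  also have "\<dots> \<le> (\<Sum>J\<in>Pow A. ((\<integral>z. F (insert i A) (insert i J) z \<partial>PiM I P)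
      + (\<integral>z. F (insert i A) J z \<partial>PiM I P)) / 2) / 2 ^ card A"
    by (intro divide_right_mono sum_mono step) auto
  also have "\<dots> = (\<Sum>J\<in>Pow (insert i A). \<integral>z. F (insert i A) J z \<partial>PiM I P) / 2 ^ card (insert i A)"
    using insert.hyps by (simp add: sum_Pow_insert sum_divide_distrib[symmetric] del: Pow_insert)
  finally show ?case .
qed

text \<open>The right-hand side is twice a Rademacher complexity, with the average over the signs written out.\<close>

theorem symmetrization:
  fixes g :: "nat \<Rightarrow> 'i \<Rightarrow> 'a \<Rightarrow> real" and c :: "'i \<Rightarrow> real"
  assumes P: "\<And>i. prob_space (P i)" and I: "finite I"
    and g: "\<And>l k. k \<in> I \<Longrightarrow> g l k \<in> borel_measurable (P k)" "\<And>l k x. \<bar>g l k x\<bar> \<le> c k"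
  shows "(\<integral>z. (SUP l. \<Sum>k\<in>I. integral\<^sup>L (P k) (g l k) - g l k (z k)) \<partial>PiM I P)
    \<le> 2 * ((\<Sum>J\<in>Pow I. \<integral>z. (SUP l. \<Sum>k\<in>I. sign_vector J k * g l k (z k)) \<partial>PiM I P) / 2 ^ card I)"
proof -
  interpret N: prob_space "PiM I P" by (intro prob_space_PiM P)
  have [measurable]: "(\<lambda>z. g l k (z k)) \<in> borel_measurable (PiM I P)" if "k \<in> I" for l k
    by (rule measurable_PiM_component[where f = "g l k", OF that]) (rule g(1)[OF that])
  have bound: "\<bar>\<Sum>k\<in>I. sign_vector J k * g l k (z k)\<bar> \<le> (\<Sum>k\<in>I. c k)" for J l z
    by (rule order_trans[OF sum_abs]) (use g(2) in \<open>auto intro!: sum_mono simp: sign_vector_def\<close>)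
  have bound2: "\<bar>\<Sum>k\<in>I. 2 * sign_vector J k * g l k (z k)\<bar> \<le> 2 * (\<Sum>k\<in>I. c k)" for J l z
    using bound[of J l z] by (simp add: sum_distrib_left[symmetric] mult.assoc abs_mult)
  have half: "(\<integral>z. (SUP l. \<Sum>k\<in>I. 2 * sign_vector J k * g l k (z k)) \<partial>PiM I P)
      \<le> 2 * (\<integral>z. (SUP l. \<Sum>k\<in>I. sign_vector J k * g l k (z k)) \<partial>PiM I P)" for J
  proof -
    have "(\<integral>z. (SUP l. \<Sum>k\<in>I. 2 * sign_vector J k * g l k (z k)) \<partial>PiM I P)
      \<le> (\<integral>z. 2 * (SUP l. \<Sum>k\<in>I. sign_vector J k * g l k (z k)) \<partial>PiM I P)"
    proof (rule integral_mono)
      show "integrable (PiM I P) (\<lambda>z. SUP l. \<Sum>k\<in>I. 2 * sign_vector J k * g l k (z k))"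
        by (rule N.integrable_SUP_bounded[OF _ bound2]) measurable
      show "integrable (PiM I P) (\<lambda>z. 2 * (SUP l. \<Sum>k\<in>I. sign_vector J k * g l k (z k)))"
        by (intro integrable_mult_right N.integrable_SUP_bounded[OF _ bound]) measurable
      show "(SUP l. \<Sum>k\<in>I. 2 * sign_vector J k * g l k (z k)) \<le> 2 * (SUP l. \<Sum>k\<in>I. sign_vector J k * g l k (z k))"
        for z
      proof (rule cSUP_least)
        fix l
        have "(\<Sum>k\<in>I. sign_vector J k * g l k (z k)) \<le> (SUP l. \<Sum>k\<in>I. sign_vector J k * g l k (z k))"
          by (rule cSUP_upper[OF _ bdd_above_bounded_seq[OF bound]]) simp
        then show "(\<Sum>k\<in>I. 2 * sign_vector J k * g l k (z k)) \<le> 2 * (SUP l. \<Sum>k\<in>I. sign_vector J k * g l k (z k))"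
          by (simp add: sum_distrib_left[symmetric] mult.assoc)
      qed simp
    qed
    then show ?thesis by simp
  qed
  have "(\<integral>z. (SUP l. \<Sum>k\<in>I. integral\<^sup>L (P k) (g l k) - g l k (z k)) \<partial>PiM I P)
    \<le> (\<Sum>J\<in>Pow I. \<integral>z. (SUP l. \<Sum>k\<in>I. 2 * sign_vector J k * g l k (z k)) \<partial>PiM I P) / 2 ^ card I"
    using symmetrization_partial[OF P I subset_refl g] by (simp cong: sum.cong)
  also have "\<dots> \<le> (\<Sum>J\<in>Pow I. 2 * (\<integral>z. (SUP l. \<Sum>k\<in>I. sign_vector J k * g l k (z k)) \<partial>PiM I P)) / 2 ^ card I"
    by (intro divide_right_mono sum_mono half) auto
  finally show ?thesis by (simp add: sum_distrib_left)
qed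

section \<open>Independence\<close>

text \<open>The case of an empty index set, in which both sides are the point mass on the empty tuple, is included so
that \<open>n = 0\<close> is no exception later.\<close>

lemma (in prob_space) distr_indep_vars_eq_PiM:
  assumes Z: "Z \<in> measurable M (PiM I N)" and ind: "indep_vars N (\<lambda>k \<omega>. Z \<omega> k) I"
  shows "distr M (PiM I N) Z = PiM I (\<lambda>k. distr M (N k) (\<lambda>\<omega>. Z \<omega> k))"
proof (cases "I = {}")
  case True
  interpret Z: prob_space "distr M (PiM I N) Z" by (rule prob_space_distr[OF Z])
  show ?thesis
  proof (rule measure_eqI)
    fix A assume "A \<in> sets (distr M (PiM I N) Z)"
    then have "A = {} \<or> A = {\<lambda>_. undefined}" using True by (auto simp: PiM_empty)
    then show "emeasure (distr M (PiM I N) Z) A = emeasure (PiM I (\<lambda>k. distr M (N k) (\<lambda>\<omega>. Z \<omega> k))) A"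
      using Z.emeasure_space_1 True by (auto simp: PiM_empty)
  qed (use True in \<open>simp add: PiM_empty\<close>)
next
  case False
  have "distr M (PiM I N) Z = distr M (PiM I N) (\<lambda>\<omega>. \<lambda>k\<in>I. Z \<omega> k)"
    using measurable_space[OF Z]
    by (intro distr_cong refl) (auto simp: space_PiM PiE_def extensional_restrict)
  also have "\<dots> = PiM I (\<lambda>k. distr M (N k) (\<lambda>\<omega>. Z \<omega> k))"
    using ind by (subst indep_vars_iff_distr_eq_PiM'[symmetric, OF False])
      (auto intro: measurable_PiM_component measurable_compose[OF Z])
  finally show ?thesis .
qed

text \<open>The \<open>t k\<close> are the essential suprema. For \<open>d > 0\<close> each event \<open>Y k > t k - d\<close> has positive probability, and by
independence so has their intersection, which therefore contains a point at which the bound \<open>C\<close> holds.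
Hence the sum of the \<open>t k - d\<close> is at most \<open>C\<close>, for every \<open>d\<close>.\<close>

lemma (in prob_space) indep_sum_bound_imp_component_bounds:
  fixes Y :: "'i \<Rightarrow> 'a \<Rightarrow> real"
  assumes "finite I" and ind: "indep_vars (\<lambda>_. borel) Y I"
    and nonneg: "\<And>k \<omega>. 0 \<le> Y k \<omega>" and bound: "AE \<omega> in M. (\<Sum>k\<in>I. Y k \<omega>) \<le> C"
  obtains t where "\<And>k. k \<in> I \<Longrightarrow> 0 \<le> t k" "\<And>k. k \<in> I \<Longrightarrow> AE \<omega> in M. Y k \<omega> \<le> t k" "(\<Sum>k\<in>I. t k) \<le> C"
proof -
  define T where "T k = esssup M (\<lambda>\<omega>. ereal (Y k \<omega>))" for k
  have Y: "Y k \<in> borel_measurable M" if "k \<in> I" for k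
    using ind that by (simp add: indep_vars_def)
  have T: "0 \<le> T k \<and> T k \<le> ereal C" if "k \<in> I" for k
  proof
    have "AE \<omega> in M. 0 \<le> T k"
      using esssup_AE[of "\<lambda>\<omega>. ereal (Y k \<omega>)" M]
    proof eventually_elim
      case (elim \<omega>)
      then show ?case using nonneg[of k \<omega>] order_trans[of 0 "ereal (Y k \<omega>)"] by (simp add: T_def)
    qed
    then show "0 \<le> T k" by simp
    have "AE \<omega> in M. ereal (Y k \<omega>) \<le> ereal C"
      using bound
    proof eventually_elim
      case (elim \<omega>)
      have "Y k \<omega> \<le> (\<Sum>k\<in>I. Y k \<omega>)"
        using \<open>finite I\<close> that nonneg by (intro member_le_sum) auto
      then show ?case using elim by simp
    qed
    then show "T k \<le> ereal C" unfolding T_def using Y[OF that] by (intro esssup_I) auto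
  qed
  define t where "t k = real_of_ereal (T k)" for k
  have Tt: "T k = ereal (t k)" if "k \<in> I" for k
    using T[OF that] by (cases "T k") (auto simp: t_def)
  have "(\<Sum>k\<in>I. t k) \<le> C"
  proof (rule field_le_epsilon)
    fix e :: real assume "0 < e"
    \<comment> \<open>the summand 1 keeps \<open>d\<close> positive when \<open>I\<close> is empty\<close>
    define d where "d = e / (card I + 1)"
    have d: "0 < d" "card I * d \<le> e" using \<open>0 < e\<close> by (auto simp: d_def field_simps)
    define E where "E = {\<omega>\<in>space M. \<forall>k\<in>I. t k - d < Y k \<omega>}"
    have "prob E > 0"
    proof (cases "I = {}")
      case True
      then show ?thesis by (simp add: E_def prob_space)
    next
      case False
      then have "E = (\<Inter>k\<in>I. Y k -` {t k - d<..} \<inter> space M)" by (auto simp: E_def)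
      then have "prob E = (\<Prod>k\<in>I. prob (Y k -` {t k - d<..} \<inter> space M))"
        using indep_varsD[OF ind False \<open>finite I\<close> subset_refl, of "\<lambda>k. {t k - d<..}"] by auto
      also have "\<dots> > 0"
      proof (rule prod_pos)
        fix k assume k: "k \<in> I"
        have "emeasure M {\<omega> \<in> space M. ereal (t k - d) < ereal (Y k \<omega>)} > 0"
          using Y[OF k] Tt[OF k] d by (intro esssup_pos_measure) (auto simp: T_def)
        moreover have "{\<omega> \<in> space M. ereal (t k - d) < ereal (Y k \<omega>)} = Y k -` {t k - d<..} \<inter> space M"
          by auto
        ultimately show "0 < prob (Y k -` {t k - d<..} \<inter> space M)"
          by (simp add: emeasure_eq_measure)
      qed
      finally show ?thesis .
    qed
    have "\<exists>\<omega>\<in>E. (\<Sum>k\<in>I. Y k \<omega>) \<le> C"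
    proof (rule ccontr)
      assume neg: "\<not> ?thesis"
      have "AE \<omega> in M. \<omega> \<notin> E" using bound by eventually_elim (use neg in auto)
      then have "prob E = 0"
        by (cases "E \<in> events") (auto simp: measure_notin_sets prob_eq_0)
      then show False using \<open>prob E > 0\<close> by simp
    qed
    then obtain \<omega> where \<omega>: "\<omega> \<in> E" "(\<Sum>k\<in>I. Y k \<omega>) \<le> C" by blast
    have "(\<Sum>k\<in>I. t k) - card I * d = (\<Sum>k\<in>I. t k - d)" by (simp add: sum_subtractf)
    also have "\<dots> \<le> (\<Sum>k\<in>I. Y k \<omega>)"
      using \<omega>(1) by (intro sum_mono) (auto simp: E_def intro!: less_imp_le)
    finally show "(\<Sum>k\<in>I. t k) \<le> C + e" using \<omega>(2) d by linarith
  qed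
  moreover have "AE \<omega> in M. Y k \<omega> \<le> t k" if "k \<in> I" for k
    using esssup_AE[of "\<lambda>\<omega>. ereal (Y k \<omega>)" M] Tt[OF that] by (simp add: T_def)
  moreover have "0 \<le> t k" if "k \<in> I" for k using T[OF that] Tt[OF that] by simp
  ultimately show thesis using that by blast
qed

lemma (in prob_space) indep_elements_imp_indep_var:
  assumes ind: "indep_elements M N X L Y" and f: "f \<in> measurable N K" and g: "g \<in> measurable L K'"
  shows "indep_var K (\<lambda>\<omega>. f (X \<omega>)) K' (\<lambda>\<omega>. g (Y \<omega>))"
proof -
  have X: "X \<in> measurable M N" and Y: "Y \<in> measurable M L"
    and iset: "indep_set {X -` A \<inter> space M | A. A \<in> sets N} {Y -` B \<inter> space M | B. B \<in> sets L}"
    using ind by (auto simp: indep_elements_def)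
  have fX: "(\<lambda>\<omega>. f (X \<omega>)) \<in> measurable M K" and gY: "(\<lambda>\<omega>. g (Y \<omega>)) \<in> measurable M K'"
    using measurable_compose[OF X f] measurable_compose[OF Y g] by auto
  have stable: "Int_stable {h -` A \<inter> space M | A. A \<in> sets R}" for h :: "'a \<Rightarrow> 'r" and R
  proof (rule Int_stableI)
    fix a b assume "a \<in> {h -` A \<inter> space M | A. A \<in> sets R}" "b \<in> {h -` A \<inter> space M | A. A \<in> sets R}"
    then obtain A B where "a = h -` A \<inter> space M" "b = h -` B \<inter> space M" "A \<in> sets R" "B \<in> sets R"
      by blast
    then have "a \<inter> b = h -` (A \<inter> B) \<inter> space M" "A \<inter> B \<in> sets R" by auto
    then show "a \<inter> b \<in> {h -` A \<inter> space M | A. A \<in> sets R}" by blast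
  qed
  have "indep_set {(\<lambda>\<omega>. f (X \<omega>)) -` A \<inter> space M | A. A \<in> sets K}
    {(\<lambda>\<omega>. g (Y \<omega>)) -` B \<inter> space M | B. B \<in> sets K'}"
  proof (rule indep_setI)
    fix a b assume "a \<in> {(\<lambda>\<omega>. f (X \<omega>)) -` A \<inter> space M | A. A \<in> sets K}"
      "b \<in> {(\<lambda>\<omega>. g (Y \<omega>)) -` B \<inter> space M | B. B \<in> sets K'}"
    then obtain A B where AB: "A \<in> sets K" "B \<in> sets K'"
      "a = (\<lambda>\<omega>. f (X \<omega>)) -` A \<inter> space M" "b = (\<lambda>\<omega>. g (Y \<omega>)) -` B \<inter> space M" by blast
    have "a = X -` (f -` A \<inter> space N) \<inter> space M" "b = Y -` (g -` B \<inter> space L) \<inter> space M"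
      using AB measurable_space[OF X] measurable_space[OF Y] by auto
    moreover have "f -` A \<inter> space N \<in> sets N" "g -` B \<inter> space L \<in> sets L"
      using AB(1,2) by (simp_all add: measurable_sets[OF f] measurable_sets[OF g])
    ultimately show "prob (a \<inter> b) = prob a * prob b"
      using indep_setD[OF iset, of a b] by blast
  qed (use measurable_sets[OF fX] measurable_sets[OF gY] in auto)
  then show ?thesis
    unfolding indep_var_eq using fX gY stable by (intro conjI indep_set_sigma_sets) auto
qed

section \<open>Averaging over Rademacher signs\<close>

lemma (in prob_space) rademacher_AE_sign:
  assumes "rademacher_sequence M n U"
  shows "AE \<omega> in M. \<forall>k\<in>{1..n}. U \<omega> k = sign_vector {k\<in>{1..n}. U \<omega> k = 1} k"
proof -
  have "AE \<omega> in M. U \<omega> k = sign_vector {k\<in>{1..n}. U \<omega> k = 1} k" if k: "k \<in> {1..n}" for k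
  proof -
    have "(\<lambda>\<omega>. U \<omega> k) \<in> borel_measurable M"
      using assms k unfolding rademacher_sequence_def indep_vars_def by auto
    then have [measurable]: "{\<omega>\<in>space M. U \<omega> k = 1} \<in> events" "{\<omega>\<in>space M. U \<omega> k = -1} \<in> events"
      by measurable
    have "prob ({\<omega>\<in>space M. U \<omega> k = 1} \<union> {\<omega>\<in>space M. U \<omega> k = -1}) =
        prob {\<omega>\<in>space M. U \<omega> k = 1} + prob {\<omega>\<in>space M. U \<omega> k = -1}"
      by (intro finite_measure_Union) auto
    also have "\<dots> = 1 / 2 + 1 / 2"
    proof -
      have "prob {\<omega>\<in>space M. U \<omega> k = 1} = 1 / 2" "prob {\<omega>\<in>space M. U \<omega> k = -1} = 1 / 2"
        using assms k unfolding rademacher_sequence_def by blast+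
      then show ?thesis by (simp only:)
    qed
    finally have "prob ({\<omega>\<in>space M. U \<omega> k = 1} \<union> {\<omega>\<in>space M. U \<omega> k = -1}) = 1" by simp
    then have "AE \<omega> in M. \<omega> \<in> {\<omega>\<in>space M. U \<omega> k = 1} \<union> {\<omega>\<in>space M. U \<omega> k = -1}"
      by (subst (asm) prob_eq_1) auto
    then show ?thesis by eventually_elim (use k in \<open>auto simp: sign_vector_def\<close>)
  qed
  then show ?thesis by (simp add: AE_finite_all)
qed

text \<open>The sample space is split according to the set on which \<open>U\<close> equals 1. Each of these events has probability
\<open>1 / 2 ^ n\<close> and is independent of \<open>Z\<close>.\<close>

lemma (in prob_space) rademacher_average:
  fixes F :: "nat set \<Rightarrow> 'z \<Rightarrow> real"
  assumes U: "rademacher_sequence M n U"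
    and ind: "indep_elements M (PiM {1..n} (\<lambda>_. borel)) U N Z"
    and F: "\<And>J. F J \<in> borel_measurable N" "\<And>J z. z \<in> space N \<Longrightarrow> \<bar>F J z\<bar> \<le> B"
  shows "integrable M (\<lambda>\<omega>. F {k\<in>{1..n}. U \<omega> k = 1} (Z \<omega>))" (is "integrable M ?f")
    and "expectation (\<lambda>\<omega>. F {k\<in>{1..n}. U \<omega> k = 1} (Z \<omega>))
      = (\<Sum>J\<in>Pow {1..n}. expectation (\<lambda>\<omega>. F J (Z \<omega>))) / 2 ^ n"
proof -
  let ?R = "PiM {1..n} (\<lambda>_. borel) :: (nat \<Rightarrow> real) measure"
  have Um[measurable]: "U \<in> measurable M ?R" and Zm: "Z \<in> measurable M N"
    using ind by (auto simp: indep_elements_def)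
  have Uk: "indep_vars (\<lambda>_. borel) (\<lambda>k \<omega>. U \<omega> k) {1..n}"
    and half: "k \<in> {1..n} \<Longrightarrow> prob {\<omega>\<in>space M. U \<omega> k = 1} = 1/2" for k
    using U by (auto simp: rademacher_sequence_def)
  have Ukm[measurable]: "(\<lambda>\<omega>. U \<omega> k) \<in> borel_measurable M" if "k \<in> {1..n}" for k
    using Uk that unfolding indep_vars_def by auto
  \<comment> \<open>deciding on the value 1 alone makes these sets partition the whole space\<close>
  define A where "A J = {u \<in> space ?R. \<forall>k\<in>{1..n}. u k = 1 \<longleftrightarrow> k \<in> J}" for J
  have memA: "U \<omega> \<in> A J \<longleftrightarrow> (\<forall>k\<in>{1..n}. U \<omega> k \<in> (if k \<in> J then {1} else - {1}))"
    if "\<omega> \<in> space M" for \<omega> J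
    using measurable_space[OF Um that] unfolding A_def by (auto split: if_splits)
  have Am: "A J \<in> sets ?R" for J
    unfolding A_def by measurable
  have probA: "expectation (\<lambda>\<omega>. indicator (A J) (U \<omega>) :: real) = 1 / 2 ^ n" for J
  proof -
    have "expectation (\<lambda>\<omega>. indicator (A J) (U \<omega>) :: real) = prob (U -` A J \<inter> space M)"
    proof -
      have "expectation (\<lambda>\<omega>. indicator (A J) (U \<omega>) :: real) = expectation (indicator (U -` A J \<inter> space M))"
        by (intro Bochner_Integration.integral_cong) (auto simp: indicator_def)
      then show ?thesis using measurable_sets[OF Um Am] by simp
    qed
    also have "\<dots> = (\<Prod>k\<in>{1..n}. prob ((\<lambda>\<omega>. U \<omega> k) -` (if k \<in> J then {1} else - {1}) \<inter> space M))"
    proof (cases "n = 0")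
      case True
      then have "U -` A J \<inter> space M = space M"
        using measurable_space[OF Um] by (auto simp: A_def)
      then show ?thesis using True by (simp add: prob_space)
    next
      case False
      then have ne: "{1..n} \<noteq> {}" by auto
      have "U -` A J \<inter> space M =
          (\<Inter>k\<in>{1..n}. (\<lambda>\<omega>. U \<omega> k) -` (if k \<in> J then {1} else - {1}) \<inter> space M)"
      proof (intro set_eqI)
        fix \<omega>
        show "\<omega> \<in> U -` A J \<inter> space M \<longleftrightarrow>
          \<omega> \<in> (\<Inter>k\<in>{1..n}. (\<lambda>\<omega>. U \<omega> k) -` (if k \<in> J then {1} else - {1}) \<inter> space M)"
        proof (cases "\<omega> \<in> space M")
          case True
          then show ?thesis using memA[OF True, of J] by (simp only: INT_iff Int_iff vimage_eq simp_thms)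
        next
          case False
          then show ?thesis using ne by blast
        qed
      qed
      then show ?thesis
        using indep_varsD[OF Uk, of "{1..n}" "\<lambda>k. if k \<in> J then {1} else - {1}"] False by auto
    qed
    also have "\<dots> = (\<Prod>k\<in>{1..n}. 1 / 2)"
    proof (rule prod.cong[OF refl])
      fix k assume k: "k \<in> {1..n}"
      have eq1: "(\<lambda>\<omega>. U \<omega> k) -` {1} \<inter> space M = {\<omega>\<in>space M. U \<omega> k = 1}" by auto
      have eq2: "(\<lambda>\<omega>. U \<omega> k) -` (- {1}) \<inter> space M = space M - {\<omega>\<in>space M. U \<omega> k = 1}" by auto
      have "{\<omega>\<in>space M. U \<omega> k = 1} \<in> events" using Ukm[OF k] by measurable
      then show "prob ((\<lambda>\<omega>. U \<omega> k) -` (if k \<in> J then {1} else - {1}) \<inter> space M) = 1 / 2"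
        using half[OF k] by (simp add: eq1 eq2 prob_compl)
    qed
    finally show ?thesis by (simp add: power_one_over)
  qed
  have indint: "integrable M (\<lambda>\<omega>. indicator (A J) (U \<omega>) :: real)" for J
  proof (rule integrable_bounded)
    show "(\<lambda>\<omega>. indicator (A J) (U \<omega>) :: real) \<in> borel_measurable M"
      by (rule measurable_compose[OF Um]) (use Am in simp)
  qed (auto simp: indicator_def)
  have Fint: "integrable M (\<lambda>\<omega>. F J (Z \<omega>))" for J
    by (rule integrable_bounded[OF measurable_compose[OF Zm F(1)] F(2)]) (rule measurable_space[OF Zm])
  have iv: "indep_var borel (\<lambda>\<omega>. indicator (A J) (U \<omega>)) borel (\<lambda>\<omega>. F J (Z \<omega>))" for J
    by (rule indep_elements_imp_indep_var[OF ind _ F(1)]) (use Am in simp)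
  have split: "?f \<omega> = (\<Sum>J\<in>Pow {1..n}. indicator (A J) (U \<omega>) * F J (Z \<omega>))"
    if \<omega>: "\<omega> \<in> space M" for \<omega>
  proof -
    have "(\<Sum>J\<in>Pow {1..n}. indicator (A J) (U \<omega>) * F J (Z \<omega>)) =
        (\<Sum>J\<in>Pow {1..n}. if J = {k\<in>{1..n}. U \<omega> k = 1} then F J (Z \<omega>) else 0)"
      using measurable_space[OF Um \<omega>]
      by (intro sum.cong refl) (auto simp: A_def indicator_def split: if_splits)
    also have "\<dots> = ?f \<omega>" by (subst sum.delta) auto
    finally show ?thesis by simp
  qed
  have int: "integrable M (\<lambda>\<omega>. \<Sum>J\<in>Pow {1..n}. indicator (A J) (U \<omega>) * F J (Z \<omega>))"
    by (intro Bochner_Integration.integrable_sum indep_var_integrable[OF iv indint Fint])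
  then show "integrable M ?f"
    by (subst Bochner_Integration.integrable_cong[OF refl split])
  have "expectation ?f = expectation (\<lambda>\<omega>. \<Sum>J\<in>Pow {1..n}. indicator (A J) (U \<omega>) * F J (Z \<omega>))"
    by (intro Bochner_Integration.integral_cong refl split)
  also have "\<dots> = (\<Sum>J\<in>Pow {1..n}. expectation (\<lambda>\<omega>. indicator (A J) (U \<omega>) * F J (Z \<omega>)))"
    by (intro Bochner_Integration.integral_sum indep_var_integrable[OF iv indint Fint])
  also have "\<dots> = (\<Sum>J\<in>Pow {1..n}. expectation (\<lambda>\<omega>. F J (Z \<omega>)) / 2 ^ n)"
    using indep_var_lebesgue_integral[OF iv indint Fint] probA by simp
  finally show "expectation ?f = (\<Sum>J\<in>Pow {1..n}. expectation (\<lambda>\<omega>. F J (Z \<omega>))) / 2 ^ n"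
    by (simp add: sum_divide_distrib)
qed

section \<open>Excess risk of an empirical minimizer under an essentially bounded envelope\<close>

text \<open>The case of an essentially bounded envelope, with \<open>c\<close> the bounds on its components and \<open>g\<close> the countable
subfamily given by pointwise measurability. Convergence is along the values of \<open>Z\<close>, which all lie in
the product of the spaces.\<close>

locale enveloped_family = prob_space M
  for M :: "'w measure" +
  fixes n :: nat and S :: "nat \<Rightarrow> 'a topology" and H :: "(nat \<Rightarrow> 'a \<Rightarrow> real) set"
    and Z :: "'w \<Rightarrow> nat \<Rightarrow> 'a" and g :: "nat \<Rightarrow> nat \<Rightarrow> 'a \<Rightarrow> real" and c :: "nat \<Rightarrow> real"
  assumes Z: "Z \<in> measurable M (prod_borel n S)"
    and Z_indep: "indep_vars (\<lambda>k. borel_of (S k)) (\<lambda>k \<omega>. Z \<omega> k) {1..n}"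
    and H_meas: "\<And>h k. h \<in> H \<Longrightarrow> k \<in> {1..n} \<Longrightarrow> h k \<in> borel_measurable (borel_of (S k))"
    and g: "\<And>l. g l \<in> H"
    and approx: "\<And>h. h \<in> H \<Longrightarrow> \<exists>l. \<forall>\<omega>\<in>space M. \<forall>k\<in>{1..n}. (\<lambda>m. g (l m) k (Z \<omega> k)) \<longlonglongrightarrow> h k (Z \<omega> k)"
    and c: "\<And>k. 0 \<le> c k"
    and bounded: "AE \<omega> in M. \<forall>h\<in>H. \<forall>k\<in>{1..n}. \<bar>h k (Z \<omega> k)\<bar> \<le> c k"
begin

\<comment> \<open>keeps index sets in the form \<open>{1..n}\<close> in which the hypotheses state them\<close>
declare One_nat_def [simp del]

text \<open>The law of the \<open>k\<close>-th component. Indices outside \<open>{1..n}\<close> get an arbitrary probability measure, because the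
results on products ask for one at every index.\<close>

definition P :: "nat \<Rightarrow> 'a measure" where
  "P k = (if k \<in> {1..n} then distr M (borel_of (S k)) (\<lambda>\<omega>. Z \<omega> k) else return (count_space UNIV) undefined)"

definition clip :: "(nat \<Rightarrow> 'a \<Rightarrow> real) \<Rightarrow> nat \<Rightarrow> 'a \<Rightarrow> real" where
  "clip h k x = max (- c k) (min (c k) (h k x))"

definition mean :: "(nat \<Rightarrow> 'a \<Rightarrow> real) \<Rightarrow> nat \<Rightarrow> real" where
  "mean h k = expectation (\<lambda>\<omega>. h k (Z \<omega> k))"

text \<open>The supremum \<open>D\<close> of the introduction, taken over the subfamily and with truncated functions. The function
\<open>fluctuation htilde\<close> below is \<open>T\<close>.\<close>

definition deviation :: "(nat \<Rightarrow> 'a) \<Rightarrow> real" where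
  "deviation z = (SUP l. \<Sum>k\<in>{1..n}. integral\<^sup>L (P k) (clip (g l) k) - clip (g l) k (z k))"

definition fluctuation :: "(nat \<Rightarrow> 'a \<Rightarrow> real) \<Rightarrow> (nat \<Rightarrow> 'a) \<Rightarrow> real" where
  "fluctuation h z = (\<Sum>k\<in>{1..n}. clip h k (z k) - integral\<^sup>L (P k) (clip h k))"

lemma Z_component: "k \<in> {1..n} \<Longrightarrow> (\<lambda>\<omega>. Z \<omega> k) \<in> measurable M (borel_of (S k))"
  by (rule measurable_compose[OF Z measurable_component_singleton])

lemma prob_space_P: "prob_space (P k)"
proof (cases "k \<in> {1..n}")
  case True
  then show ?thesis by (simp only: P_def if_True prob_space_distr[OF Z_component])
qed (auto simp: P_def intro: prob_space_return)

lemma PiM_P_eq: "PiM {1..n} P = PiM {1..n} (\<lambda>k. distr M (borel_of (S k)) (\<lambda>\<omega>. Z \<omega> k))"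
  by (intro PiM_cong) (auto simp: P_def)

lemma law_Z: "distr M (prod_borel n S) Z = PiM {1..n} P"
  unfolding PiM_P_eq by (rule distr_indep_vars_eq_PiM[OF Z Z_indep])

lemma sets_PiM_P: "sets (PiM {1..n} P) = sets (prod_borel n S)"
  by (simp flip: law_Z)

lemma Z_PiM_P: "Z \<in> measurable M (PiM {1..n} P)"
  using Z by (simp cong: measurable_cong_sets add: sets_PiM_P)

lemma expectation_Z:
  fixes f :: "(nat \<Rightarrow> 'a) \<Rightarrow> real"
  assumes "f \<in> borel_measurable (PiM {1..n} P)"
  shows "expectation (\<lambda>\<omega>. f (Z \<omega>)) = integral\<^sup>L (PiM {1..n} P) f"
proof -
  have "f \<in> borel_measurable (prod_borel n S)"
    using assms by (simp cong: measurable_cong_sets add: sets_PiM_P)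
  then show ?thesis unfolding law_Z[symmetric] by (subst integral_distr[OF Z]) auto
qed

lemma prob_Z:
  assumes "f \<in> borel_measurable (PiM {1..n} P)"
  shows "prob {\<omega>\<in>space M. t \<le> (f (Z \<omega>) :: real)} =
    measure (PiM {1..n} P) {z\<in>space (PiM {1..n} P). t \<le> f z}"
proof -
  have f: "f \<in> borel_measurable (prod_borel n S)"
    using assms by (simp cong: measurable_cong_sets add: sets_PiM_P)
  have "{z\<in>space (prod_borel n S). t \<le> f z} \<in> sets (prod_borel n S)"
    using f by measurable
  then have "measure (distr M (prod_borel n S) Z) {z\<in>space (prod_borel n S). t \<le> f z} =
    prob (Z -` {z\<in>space (prod_borel n S). t \<le> f z} \<inter> space M)"
    by (rule measure_distr[OF Z])
  also have "Z -` {z\<in>space (prod_borel n S). t \<le> f z} \<inter> space M = {\<omega>\<in>space M. t \<le> f (Z \<omega>)}"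
    using measurable_space[OF Z] by auto
  finally show ?thesis
    using sets_eq_imp_space_eq[OF sets_PiM_P] by (simp add: law_Z)
qed

lemma abs_clip_le: "\<bar>clip h k x\<bar> \<le> c k"
  using c[of k] by (auto simp: clip_def)

lemma clip_id: "\<bar>h k x\<bar> \<le> c k \<Longrightarrow> clip h k x = h k x"
  by (auto simp: clip_def)

lemma clip_measurable:
  assumes "h \<in> H" "k \<in> {1..n}"
  shows "clip h k \<in> borel_measurable (P k)"
proof -
  note [measurable] = H_meas[OF assms]
  have "clip h k \<in> borel_measurable (borel_of (S k))"
    unfolding clip_def[abs_def] by measurable
  then show ?thesis using assms by (simp add: P_def)
qed

lemma clip_component_measurable:
  assumes "h \<in> H" "k \<in> {1..n}"
  shows "(\<lambda>z. clip h k (z k)) \<in> borel_measurable (PiM {1..n} P)"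
  by (rule measurable_PiM_component[where f = "clip h k" and P = P and k = k,
        OF assms(2) clip_measurable[OF assms]])

lemma AE_clip: "AE \<omega> in M. \<forall>h\<in>H. \<forall>k\<in>{1..n}. clip h k (Z \<omega> k) = h k (Z \<omega> k)"
  using bounded by eventually_elim (auto intro: clip_id)

lemma integrable_component:
  assumes "h \<in> H" "k \<in> {1..n}"
  shows "integrable M (\<lambda>\<omega>. h k (Z \<omega> k))"
proof (rule integrable_const_bound[of _ "c k"])
  show "AE \<omega> in M. norm (h k (Z \<omega> k)) \<le> c k"
    using bounded by eventually_elim (use assms in auto)
qed (rule measurable_compose[OF Z_component[OF assms(2)] H_meas[OF assms]])

lemma mean_clip:
  assumes "h \<in> H" "k \<in> {1..n}"
  shows "integral\<^sup>L (P k) (clip h k) = mean h k"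
proof -
  have m: "clip h k \<in> borel_measurable (borel_of (S k))"
    using clip_measurable[OF assms] assms(2) by (simp add: P_def)
  have "integral\<^sup>L (P k) (clip h k) = expectation (\<lambda>\<omega>. clip h k (Z \<omega> k))"
    using assms(2) by (simp add: P_def integral_distr[OF Z_component m])
  also have "\<dots> = mean h k"
    unfolding mean_def
  proof (rule integral_cong_AE)
    show "AE \<omega> in M. clip h k (Z \<omega> k) = h k (Z \<omega> k)"
      using AE_clip by eventually_elim (use assms in auto)
  qed (use measurable_compose[OF Z_component m] integrable_component[OF assms] assms(2) in auto)
  finally show ?thesis .
qed

lemma abs_mean_clip_le: "k \<in> {1..n} \<Longrightarrow> h \<in> H \<Longrightarrow> \<bar>integral\<^sup>L (P k) (clip h k)\<bar> \<le> c k"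
  by (intro prob_space.abs_expectation_le[OF prob_space_P] clip_measurable abs_clip_le)

lemma deviation_term_bound:
  assumes "h \<in> H"
  shows "\<bar>\<Sum>k\<in>{1..n}. integral\<^sup>L (P k) (clip h k) - clip h k (z k)\<bar> \<le> (\<Sum>k\<in>{1..n}. 2 * c k)"
proof (rule order_trans[OF sum_abs], rule sum_mono)
  fix k assume "k \<in> {1..n}"
  then show "\<bar>integral\<^sup>L (P k) (clip h k) - clip h k (z k)\<bar> \<le> 2 * c k"
    using abs_mean_clip_le[OF _ assms, of k] abs_clip_le[of h k "z k"] by linarith
qed

lemma deviation_measurable: "deviation \<in> borel_measurable (PiM {1..n} P)"
  unfolding deviation_def[abs_def]
  by (rule measurable_SUP_bounded[OF _ deviation_term_bound[OF g]])
    (intro borel_measurable_sum borel_measurable_diff clip_component_measurable g borel_measurable_const)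

lemma deviation_bound: "\<bar>deviation z\<bar> \<le> (\<Sum>k\<in>{1..n}. 2 * c k)"
  unfolding deviation_def by (rule abs_SUP_le[OF deviation_term_bound[OF g]])

lemma fluctuation_measurable: "h \<in> H \<Longrightarrow> fluctuation h \<in> borel_measurable (PiM {1..n} P)"
  unfolding fluctuation_def[abs_def]
  by (intro borel_measurable_sum borel_measurable_diff clip_component_measurable borel_measurable_const)

lemma fluctuation_bound: "h \<in> H \<Longrightarrow> \<bar>fluctuation h z\<bar> \<le> (\<Sum>k\<in>{1..n}. 2 * c k)"
  using deviation_term_bound[of h z] unfolding fluctuation_def
  by (simp add: sum_subtractf abs_minus_commute)

lemma clip_sum_upd:
  assumes "i \<in> {1..n}"
  shows "(\<Sum>k\<in>{1..n}. f k (clip h k ((z(i := x)) k))) - (\<Sum>k\<in>{1..n}. f k (clip h k (z k)))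
    = f i (clip h i x) - (f i (clip h i (z i)) :: real)"
proof -
  have "(\<Sum>k\<in>{1..n} - {i}. f k (clip h k ((z(i := x)) k))) = (\<Sum>k\<in>{1..n} - {i}. f k (clip h k (z k)))"
    by (intro sum.cong) auto
  then show ?thesis using assms by (simp add: sum.remove[of "{1..n}" i] del: fun_upd_apply) simp
qed

lemma deviation_upd:
  assumes "i \<in> {1..n}"
  shows "deviation (z(i := x)) - deviation z \<le> 2 * c i"
proof -
  have "deviation (z(i := x)) \<le> deviation z + 2 * c i"
    unfolding deviation_def
  proof (rule SUP_le_SUP_add[OF deviation_term_bound[OF g]])
    fix l
    show "(\<Sum>k\<in>{1..n}. integral\<^sup>L (P k) (clip (g l) k) - clip (g l) k ((z(i := x)) k))
      \<le> (\<Sum>k\<in>{1..n}. integral\<^sup>L (P k) (clip (g l) k) - clip (g l) k (z k)) + 2 * c i"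
      using clip_sum_upd[OF assms, of "\<lambda>k u. integral\<^sup>L (P k) (clip (g l) k) - u" "g l" z x]
        abs_clip_le[of "g l" i x] abs_clip_le[of "g l" i "z i"] by linarith
  qed
  then show ?thesis by linarith
qed

lemma fluctuation_upd:
  assumes "i \<in> {1..n}"
  shows "fluctuation h (z(i := x)) - fluctuation h z \<le> 2 * c i"
  using clip_sum_upd[OF assms, of "\<lambda>k u. u - integral\<^sup>L (P k) (clip h k)" h z x]
    abs_clip_le[of h i x] abs_clip_le[of h i "z i"] unfolding fluctuation_def by linarith

lemma expectation_fluctuation:
  assumes "h \<in> H"
  shows "integral\<^sup>L (PiM {1..n} P) (fluctuation h) = 0"
proof -
  have "integral\<^sup>L (PiM {1..n} P) (fluctuation h) = expectation (\<lambda>\<omega>. fluctuation h (Z \<omega>))"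
    by (rule expectation_Z[OF fluctuation_measurable[OF assms], symmetric])
  also have "\<dots> = expectation (\<lambda>\<omega>. \<Sum>k\<in>{1..n}. h k (Z \<omega> k) - mean h k)"
  proof (rule integral_cong_AE)
    show "AE \<omega> in M. fluctuation h (Z \<omega>) = (\<Sum>k\<in>{1..n}. h k (Z \<omega> k) - mean h k)"
      using AE_clip
      by eventually_elim (use assms in \<open>auto simp: fluctuation_def mean_clip intro!: sum.cong\<close>)
    show "(\<lambda>\<omega>. fluctuation h (Z \<omega>)) \<in> borel_measurable M"
      by (rule measurable_compose[OF Z_PiM_P fluctuation_measurable[OF assms]])
  qed (use integrable_component[OF assms] in \<open>auto intro!: borel_measurable_sum\<close>)
  also have "\<dots> = 0"
    using integrable_component[OF assms]
    by (subst Bochner_Integration.integral_sum) (auto simp: mean_def prob_space)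
  finally show ?thesis .
qed

text \<open>The supremum over the subfamily \<open>g\<close> controls all of \<open>H\<close>, outside one null set that does not depend on \<open>h\<close>,
so that \<open>h\<close> may afterwards be chosen in dependence on the sample. The empirical part passes to the limit by
pointwise convergence, the expectations by dominated convergence.\<close>

lemma mean_deviation_le_deviation:
  "AE \<omega> in M. \<forall>h\<in>H. (\<Sum>k\<in>{1..n}. mean h k - h k (Z \<omega> k)) \<le> deviation (Z \<omega>)"
  using AE_clip AE_space
proof eventually_elim
  case (elim \<omega>)
  show ?case
  proof
    fix h assume h: "h \<in> H"
    obtain l where l: "\<And>\<omega> k. \<omega> \<in> space M \<Longrightarrow> k \<in> {1..n} \<Longrightarrow> (\<lambda>m. g (l m) k (Z \<omega> k)) \<longlonglongrightarrow> h k (Z \<omega> k)"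
      using approx[OF h] by blast
    have mean: "(\<lambda>m. mean (g (l m)) k) \<longlonglongrightarrow> mean h k" if k: "k \<in> {1..n}" for k
      unfolding mean_def
    proof (rule integral_dominated_convergence[where w = "\<lambda>_. c k"])
      show "AE \<omega> in M. norm (g (l m) k (Z \<omega> k)) \<le> c k" for m
        using bounded by eventually_elim (use g k in auto)
    qed (use l k integrable_component[OF h k] integrable_component[OF g k] in auto)
    have lim: "(\<lambda>m. \<Sum>k\<in>{1..n}. mean (g (l m)) k - g (l m) k (Z \<omega> k))
        \<longlonglongrightarrow> (\<Sum>k\<in>{1..n}. mean h k - h k (Z \<omega> k))"
      by (intro tendsto_sum tendsto_diff mean l elim)
    show "(\<Sum>k\<in>{1..n}. mean h k - h k (Z \<omega> k)) \<le> deviation (Z \<omega>)"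
    proof (rule LIMSEQ_le_const2[OF lim], intro exI allI impI)
      fix m
      have "(\<Sum>k\<in>{1..n}. mean (g (l m)) k - g (l m) k (Z \<omega> k)) =
          (\<Sum>k\<in>{1..n}. integral\<^sup>L (P k) (clip (g (l m)) k) - clip (g (l m)) k (Z \<omega> k))"
        using elim g by (intro sum.cong refl) (simp add: mean_clip)
      also have "\<dots> \<le> deviation (Z \<omega>)"
        unfolding deviation_def
        using bdd_above_bounded_seq[OF deviation_term_bound[OF g], of "\<lambda>l. l"]
        by (intro cSUP_upper2[of _ _ "l m"]) auto
      finally show "(\<Sum>k\<in>{1..n}. mean (g (l m)) k - g (l m) k (Z \<omega> k)) \<le> deviation (Z \<omega>)" .
    qed
  qed
qed

lemma mean_difference_eq:
  assumes copy: "independent_copy M (prod_borel n S) Z Z'" and h: "h \<in> H" "h' \<in> H"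
  shows "mean_difference M n Z' h h' = ereal (\<Sum>k\<in>{1..n}. mean h k - mean h' k)"
proof -
  have Z': "Z' \<in> measurable M (prod_borel n S)" and law: "distr M (prod_borel n S) Z' = distr M (prod_borel n S) Z"
    using copy by (auto simp: independent_copy_def indep_elements_def)
  have "ext_expectation M (\<lambda>\<omega>. ereal (h k (Z' \<omega> k) - h' k (Z' \<omega> k))) = ereal (mean h k - mean h' k)"
    if k: "k \<in> {1..n}" for k
  proof -
    define f where "f z = h k (z k) - h' k (z k)" for z
    have comp: "(\<lambda>z. h k (z k)) \<in> borel_measurable (prod_borel n S)" if "h \<in> H" for h
      by (rule measurable_PiM_component[where f = "h k" and P = "\<lambda>k. borel_of (S k)" and k = k,
            OF k H_meas[OF that k]])
    have f: "f \<in> borel_measurable (prod_borel n S)"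
      unfolding f_def by (intro borel_measurable_diff comp h)
    have int: "integrable M (\<lambda>\<omega>. f (Z \<omega>))"
      unfolding f_def by (intro Bochner_Integration.integrable_diff integrable_component h k)
    then have "integrable M (\<lambda>\<omega>. f (Z' \<omega>))"
      using integrable_distr_eq[OF Z f] integrable_distr_eq[OF Z' f] by (simp add: law)
    then have "ext_expectation M (\<lambda>\<omega>. ereal (f (Z' \<omega>))) = ereal (expectation (\<lambda>\<omega>. f (Z' \<omega>)))"
      by (rule ext_expectation_eq_integral)
    also have "expectation (\<lambda>\<omega>. f (Z' \<omega>)) = expectation (\<lambda>\<omega>. f (Z \<omega>))"
      using integral_distr[OF Z f] integral_distr[OF Z' f] by (simp add: law)
    also have "\<dots> = mean h k - mean h' k"
      unfolding f_def mean_def by (intro Bochner_Integration.integral_diff integrable_component h k)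
    finally show ?thesis unfolding f_def .
  qed
  then show ?thesis unfolding mean_difference_def by simp
qed

text \<open>Adding and subtracting the empirical sums of \<open>hhat\<close> and \<open>htilde\<close> leaves the deviation at \<open>hhat\<close>, the
fluctuation of \<open>htilde\<close>, and the difference of the two empirical sums, which is not positive because \<open>hhat\<close>
minimizes.\<close>

lemma excess_le_deviation_plus_fluctuation:
  assumes copy: "independent_copy M (prod_borel n S) Z Z'" and ht: "htilde \<in> H"
    and hh: "\<forall>\<omega>\<in>space M. is_arg_min (\<lambda>h. \<Sum>k=1..n. h k (Z \<omega> k)) (\<lambda>h. h \<in> H) (hhat (Z \<omega>))"
  shows "AE \<omega> in M. mean_difference M n Z' (hhat (Z \<omega>)) htilde
    \<le> ereal (deviation (Z \<omega>) + fluctuation htilde (Z \<omega>))"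
  using mean_deviation_le_deviation AE_clip AE_space
proof eventually_elim
  case (elim \<omega>)
  have hH: "hhat (Z \<omega>) \<in> H" and min: "(\<Sum>k\<in>{1..n}. hhat (Z \<omega>) k (Z \<omega> k)) \<le> (\<Sum>k\<in>{1..n}. htilde k (Z \<omega> k))"
    using hh elim(3) ht by (auto simp: is_arg_min_linorder)
  have "(\<Sum>k\<in>{1..n}. mean (hhat (Z \<omega>)) k - hhat (Z \<omega>) k (Z \<omega> k)) \<le> deviation (Z \<omega>)"
    using elim(1) hH by blast
  moreover have "fluctuation htilde (Z \<omega>) = (\<Sum>k\<in>{1..n}. htilde k (Z \<omega> k) - mean htilde k)"
    unfolding fluctuation_def using elim(2) ht by (intro sum.cong refl) (simp add: mean_clip)
  ultimately show ?case
    using min by (simp add: mean_difference_eq[OF copy hH ht] sum_subtractf)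
qed

lemma rademacher_complexity_eq:
  assumes U: "rademacher_sequence M n U" and ind: "indep_elements M (PiM {1..n} (\<lambda>_. borel)) U (prod_borel n S) Z"
  shows "rademacher_complexity M n U H Z = ereal
    ((\<Sum>J\<in>Pow {1..n}. \<integral>z. (SUP l. \<Sum>k\<in>{1..n}. sign_vector J k * clip (g l) k (z k)) \<partial>PiM {1..n} P) / 2 ^ n)"
proof -
  define F where "F J z = (SUP l. \<Sum>k\<in>{1..n}. sign_vector J k * clip (g l) k (z k))" for J z
  have bound: "\<bar>\<Sum>k\<in>{1..n}. sign_vector J k * clip (g l) k (z k)\<bar> \<le> (\<Sum>k\<in>{1..n}. c k)" for J l z
    by (rule order_trans[OF sum_abs]) (use abs_clip_le in \<open>auto intro!: sum_mono simp: sign_vector_def\<close>)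
  have Fm: "F J \<in> borel_measurable (PiM {1..n} P)" for J
    unfolding F_def[abs_def]
    by (rule measurable_SUP_bounded[OF _ bound])
      (intro borel_measurable_sum borel_measurable_times clip_component_measurable g borel_measurable_const)
  then have Fm': "F J \<in> borel_measurable (prod_borel n S)" for J
    by (simp cong: measurable_cong_sets add: sets_PiM_P)
  have FB: "\<bar>F J z\<bar> \<le> (\<Sum>k\<in>{1..n}. c k)" for J z
    unfolding F_def by (rule abs_SUP_le[OF bound])
  note avg = rademacher_average[OF U ind Fm' FB]
  let ?J = "\<lambda>\<omega>. {k\<in>{1..n}. U \<omega> k = 1}"
  have "AE \<omega> in M. (SUP h\<in>H. ereal (\<Sum>k=1..n. U \<omega> k * h k (Z \<omega> k))) = ereal (F (?J \<omega>) (Z \<omega>))"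
    using rademacher_AE_sign[OF U] AE_clip AE_space
  proof eventually_elim
    case (elim \<omega>)
    have clip: "(\<Sum>k\<in>{1..n}. sign_vector (?J \<omega>) k * clip (g l) k (Z \<omega> k)) = (\<Sum>k\<in>{1..n}. U \<omega> k * g l k (Z \<omega> k))" for l
      using elim(1,2) g by (intro sum.cong refl) simp
    have upper: "(SUP h\<in>H. ereal (\<Sum>k=1..n. U \<omega> k * h k (Z \<omega> k))) \<le> ereal (F (?J \<omega>) (Z \<omega>))"
    proof (rule SUP_least)
      fix h assume h: "h \<in> H"
      obtain l where l: "\<And>k. k \<in> {1..n} \<Longrightarrow> (\<lambda>m. g (l m) k (Z \<omega> k)) \<longlonglongrightarrow> h k (Z \<omega> k)"
        using approx[OF h] elim(3) by blast
      have lim: "(\<lambda>m. \<Sum>k\<in>{1..n}. U \<omega> k * g (l m) k (Z \<omega> k)) \<longlonglongrightarrow> (\<Sum>k\<in>{1..n}. U \<omega> k * h k (Z \<omega> k))"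
        by (intro tendsto_sum tendsto_mult_left l)
      have "(\<Sum>k\<in>{1..n}. U \<omega> k * g (l m) k (Z \<omega> k)) \<le> F (?J \<omega>) (Z \<omega>)" for m
        unfolding F_def clip[symmetric]
        by (rule cSUP_upper[OF _ bdd_above_bounded_seq[OF bound]]) simp
      then show "ereal (\<Sum>k=1..n. U \<omega> k * h k (Z \<omega> k)) \<le> ereal (F (?J \<omega>) (Z \<omega>))"
        using LIMSEQ_le_const2[OF lim] by simp
    qed
    \<comment> \<open>the upper bound makes this supremum finite, so that it can be compared with a real one\<close>
    define s where "s = (SUP h\<in>H. ereal (\<Sum>k=1..n. U \<omega> k * h k (Z \<omega> k)))"
    have s: "ereal (\<Sum>k\<in>{1..n}. U \<omega> k * g l k (Z \<omega> k)) \<le> s" for l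
      unfolding s_def using g by (rule SUP_upper)
    obtain r where r: "s = ereal r"
      using s[of 0] upper unfolding s_def[symmetric] by (cases s) auto
    have "F (?J \<omega>) (Z \<omega>) \<le> r"
      unfolding F_def clip by (rule cSUP_least) (use s r in auto)
    then show ?case using upper r unfolding s_def[symmetric] by simp
  qed
  then have "rademacher_complexity M n U H Z = ext_expectation M (\<lambda>\<omega>. ereal (F (?J \<omega>) (Z \<omega>)))"
    unfolding rademacher_complexity_def ext_expectation_def
    by (intro arg_cong2[where f = "(-)"] arg_cong[where f = enn2ereal] nn_integral_cong_AE;
        elim eventually_mono) auto
  also have "\<dots> = ereal (expectation (\<lambda>\<omega>. F (?J \<omega>) (Z \<omega>)))"
    by (rule ext_expectation_eq_integral[OF avg(1)])
  also have "\<dots> = ereal ((\<Sum>J\<in>Pow {1..n}. integral\<^sup>L (PiM {1..n} P) (F J)) / 2 ^ n)"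
    using avg(2) by (simp add: expectation_Z[OF Fm])
  finally show ?thesis unfolding F_def[abs_def] .
qed

lemma expectation_deviation_le:
  assumes "rademacher_sequence M n U" "indep_elements M (PiM {1..n} (\<lambda>_. borel)) U (prod_borel n S) Z"
  obtains r where "rademacher_complexity M n U H Z = ereal r"
    and "integral\<^sup>L (PiM {1..n} P) deviation \<le> 2 * r"
proof
  show "integral\<^sup>L (PiM {1..n} P) deviation \<le> 2 *
    ((\<Sum>J\<in>Pow {1..n}. \<integral>z. (SUP l. \<Sum>k\<in>{1..n}. sign_vector J k * clip (g l) k (z k)) \<partial>PiM {1..n} P) / 2 ^ n)"
    unfolding deviation_def[abs_def]
    using symmetrization[where I = "{1..n}" and P = P and g = "\<lambda>l. clip (g l)" and c = c,
        OF prob_space_P finite_atLeastAtMost clip_measurable[OF g] abs_clip_le] by simp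
qed (rule rademacher_complexity_eq[OF assms])

text \<open>Oscillations \<open>2 * c k\<close> give McDiarmid's inequality the parameter \<open>4 * L\<^sup>2\<close>, hence the exponent
\<open>- 2 * e\<^sup>2 / (4 * L\<^sup>2)\<close>. The exceptional event is given as a measurable superset, since the event about \<open>hhat\<close>
itself need not be measurable.\<close>

theorem excess_tail:
  assumes copy: "independent_copy M (prod_borel n S) Z Z'" and ht: "htilde \<in> H"
    and hh: "\<forall>\<omega>\<in>space M. is_arg_min (\<lambda>h. \<Sum>k=1..n. h k (Z \<omega> k)) (\<lambda>h. h \<in> H) (hhat (Z \<omega>))"
    and U: "rademacher_sequence M n U"
      "indep_elements M (PiM {1..n} (\<lambda>_. borel)) U (prod_borel n S) Z"
    and e: "0 < e" and L: "(\<Sum>k\<in>{1..n}. (c k)\<^sup>2) \<le> L\<^sup>2" "0 < L"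
  obtains A where "A \<in> events" "prob A \<le> 2 * exp (- (e / (sqrt 2 * L))\<^sup>2)"
    "\<And>\<omega>. \<omega> \<in> space M - A \<Longrightarrow> mean_difference M n Z' (hhat (Z \<omega>)) htilde
      \<le> 2 * (ereal e + rademacher_complexity M n U H Z)"
proof -
  obtain r where r: "rademacher_complexity M n U H Z = ereal r"
    and dev: "integral\<^sup>L (PiM {1..n} P) deviation \<le> 2 * r"
    using expectation_deviation_le[OF U] .
  have tail: "prob {\<omega>\<in>space M. e \<le> f (Z \<omega>) - integral\<^sup>L (PiM {1..n} P) f} \<le> exp (- (e / (sqrt 2 * L))\<^sup>2)"
    and event: "{\<omega>\<in>space M. e \<le> f (Z \<omega>) - integral\<^sup>L (PiM {1..n} P) f} \<in> events"
    if f: "f \<in> borel_measurable (PiM {1..n} P)" "\<And>z. \<bar>f z\<bar> \<le> B"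
      "\<And>i z x. i \<in> {1..n} \<Longrightarrow> f (z(i := x)) - f z \<le> 2 * c i" for f B
  proof -
    have v: "(\<Sum>k\<in>{1..n}. (2 * c k)\<^sup>2) \<le> 4 * L\<^sup>2"
      using L by (simp add: power_mult_distrib sum_distrib_left[symmetric])
    have "prob {\<omega>\<in>space M. e \<le> f (Z \<omega>) - integral\<^sup>L (PiM {1..n} P) f} =
      measure (PiM {1..n} P) {z\<in>space (PiM {1..n} P). e \<le> f z - integral\<^sup>L (PiM {1..n} P) f}"
      by (intro prob_Z borel_measurable_diff f(1) borel_measurable_const)
    also have "\<dots> \<le> exp (- 2 * e\<^sup>2 / (4 * L\<^sup>2))"
      by (rule McDiarmid[OF prob_space_P finite_atLeastAtMost f(1,2) _ e v]) (use f(3) L in auto)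
    also have "- 2 * e\<^sup>2 / (4 * L\<^sup>2) = - (e / (sqrt 2 * L))\<^sup>2"
      using L by (simp add: power_divide power_mult_distrib)
    finally show "prob {\<omega>\<in>space M. e \<le> f (Z \<omega>) - integral\<^sup>L (PiM {1..n} P) f} \<le> exp (- (e / (sqrt 2 * L))\<^sup>2)" .
    have "(\<lambda>\<omega>. f (Z \<omega>)) \<in> borel_measurable M" by (rule measurable_compose[OF Z_PiM_P f(1)])
    then show "{\<omega>\<in>space M. e \<le> f (Z \<omega>) - integral\<^sup>L (PiM {1..n} P) f} \<in> events" by measurable
  qed
  define A1 where "A1 = {\<omega>\<in>space M. e \<le> deviation (Z \<omega>) - integral\<^sup>L (PiM {1..n} P) deviation}"
  define A2 where "A2 = {\<omega>\<in>space M. e \<le> fluctuation htilde (Z \<omega>)}"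
  have A1: "A1 \<in> events" "prob A1 \<le> exp (- (e / (sqrt 2 * L))\<^sup>2)"
    unfolding A1_def
    using event[OF deviation_measurable deviation_bound deviation_upd]
      tail[OF deviation_measurable deviation_bound deviation_upd] by auto
  have A2: "A2 \<in> events" "prob A2 \<le> exp (- (e / (sqrt 2 * L))\<^sup>2)"
    unfolding A2_def
    using event[OF fluctuation_measurable[OF ht] fluctuation_bound[OF ht] fluctuation_upd]
      tail[OF fluctuation_measurable[OF ht] fluctuation_bound[OF ht] fluctuation_upd]
    by (auto simp: expectation_fluctuation[OF ht])
  obtain N where N: "N \<in> null_sets M" and
    excess: "\<And>\<omega>. \<omega> \<in> space M - N \<Longrightarrow> mean_difference M n Z' (hhat (Z \<omega>)) htilde
      \<le> ereal (deviation (Z \<omega>) + fluctuation htilde (Z \<omega>))"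
    using AE_E3[OF excess_le_deviation_plus_fluctuation[OF copy ht hh]] by blast
  show thesis
  proof
    show "N \<union> (A1 \<union> A2) \<in> events" using N A1 A2 by auto
    have "prob (N \<union> (A1 \<union> A2)) = prob (A1 \<union> A2)"
      using measure_Un_null_set[of "A1 \<union> A2" M N] N A1(1) A2(1) by (simp only: Un_commute sets.Un)
    also have "\<dots> \<le> prob A1 + prob A2" using A1 A2 by (intro measure_Un_le) auto
    finally show "prob (N \<union> (A1 \<union> A2)) \<le> 2 * exp (- (e / (sqrt 2 * L))\<^sup>2)"
      using A1 A2 by linarith
    fix \<omega> assume "\<omega> \<in> space M - (N \<union> (A1 \<union> A2))"
    then have \<omega>: "\<omega> \<in> space M - N" "deviation (Z \<omega>) - integral\<^sup>L (PiM {1..n} P) deviation < e"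
      "fluctuation htilde (Z \<omega>) < e"
      by (auto simp: A1_def A2_def)
    have sum: "x + y \<le> 2 * (e + r)" if "x - m < e" "y < e" "m \<le> 2 * r" for x y m
      using that by (simp add: field_simps)
    have "deviation (Z \<omega>) + fluctuation htilde (Z \<omega>) \<le> 2 * (e + r)"
      by (rule sum[OF \<omega>(2,3) dev])
    then show "mean_difference M n Z' (hhat (Z \<omega>)) htilde \<le> 2 * (ereal e + rademacher_complexity M n U H Z)"
      using order_trans[OF excess[OF \<omega>(1)]] by (simp add: r)
  qed
qed

text \<open>The limiting case \<open>L = 0\<close> of the tail bound, whose exponent would have denominator 0. Every expectation is
0, and the complexity is nonnegative because twice its value bounds the expectation of the zero deviation.\<close>

lemma degenerate_excess:
  assumes copy: "independent_copy M (prod_borel n S) Z Z'" and h: "h \<in> H" "h' \<in> H"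
    and U: "rademacher_sequence M n U"
      "indep_elements M (PiM {1..n} (\<lambda>_. borel)) U (prod_borel n S) Z"
    and zero: "\<And>k. k \<in> {1..n} \<Longrightarrow> c k = 0"
  shows "mean_difference M n Z' h h' = 0" "0 \<le> rademacher_complexity M n U H Z"
proof -
  have mean0: "mean h k = 0" if "h \<in> H" "k \<in> {1..n}" for h k
    using abs_mean_clip_le[OF that(2,1)] mean_clip[OF that] zero[OF that(2)] by simp
  then show "mean_difference M n Z' h h' = 0"
    using h by (simp add: mean_difference_eq[OF copy h])
  have "deviation = (\<lambda>_. 0)" using deviation_bound zero by (auto simp: fun_eq_iff)
  then have "integral\<^sup>L (PiM {1..n} P) deviation = 0" by simp
  then show "0 \<le> rademacher_complexity M n U H Z"
    using expectation_deviation_le[OF U] by (metis ereal_less_eq(5) mult_le_0_iff not_numeral_le_zero zero_le_mult_iff)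
qed

end

section \<open>The envelope and its essential norm\<close>

lemma ext_sqrt_le_imp_le_square:
  assumes "0 \<le> s" "ext_sqrt s \<le> ereal L"
  shows "s \<le> ereal (L\<^sup>2)"
proof (cases s)
  case (real r)
  then have "0 \<le> r" "sqrt r \<le> L" using assms by (auto simp: ext_sqrt_def)
  then have "r \<le> L\<^sup>2" using real_le_lsqrt sqrt_le_D by blast
  then show ?thesis using real by simp
qed (use assms in \<open>auto simp: ext_sqrt_def\<close>)

lemma envelope_eq_countable_SUP:
  fixes g :: "nat \<Rightarrow> nat \<Rightarrow> 'a \<Rightarrow> real"
  assumes "\<And>l. g l \<in> H"
    and "\<And>h. h \<in> H \<Longrightarrow> \<exists>l. (\<lambda>m. g (l m) k x) \<longlonglongrightarrow> h k x"
  shows "envelope H k x = (SUP l. ereal \<bar>g l k x\<bar>)"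
  unfolding envelope_def
proof (rule antisym)
  show "(SUP h\<in>H. ereal \<bar>h k x\<bar>) \<le> (SUP l. ereal \<bar>g l k x\<bar>)"
  proof (rule SUP_least)
    fix h assume "h \<in> H"
    then obtain l where "(\<lambda>m. g (l m) k x) \<longlonglongrightarrow> h k x" using assms(2) by blast
    then have "(\<lambda>m. ereal \<bar>g (l m) k x\<bar>) \<longlonglongrightarrow> ereal \<bar>h k x\<bar>"
      by (intro tendsto_ereal tendsto_rabs)
    then show "ereal \<bar>h k x\<bar> \<le> (SUP l. ereal \<bar>g l k x\<bar>)"
      by (rule LIMSEQ_le_const2) (intro exI allI impI SUP_upper UNIV_I)
  qed
  show "(SUP l. ereal \<bar>g l k x\<bar>) \<le> (SUP h\<in>H. ereal \<bar>h k x\<bar>)"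
    using assms(1) by (intro SUP_least SUP_upper)
qed

text \<open>The squared envelopes of the components are independent and their sum is at most \<open>L\<^sup>2\<close> almost surely, so the
square roots of the bounds from \<open>indep_sum_bound_imp_component_bounds\<close> serve as \<open>c\<close>.\<close>

lemma (in prob_space) envelope_component_bounds:
  fixes g :: "nat \<Rightarrow> nat \<Rightarrow> 'b \<Rightarrow> real"
  assumes Z: "Z \<in> measurable M (prod_borel n S)"
    and ind: "indep_vars (\<lambda>k. borel_of (S k)) (\<lambda>k \<omega>. Z \<omega> k) {1..n}"
    and meas: "\<And>h k. h \<in> H \<Longrightarrow> k \<in> {1..n} \<Longrightarrow> h k \<in> borel_measurable (borel_of (S k))"
    and g: "\<And>l. g l \<in> H"
    and approx: "\<And>h. h \<in> H \<Longrightarrow> \<exists>l. \<forall>\<omega>\<in>space M. \<forall>k\<in>{1..n}. (\<lambda>m. g (l m) k (Z \<omega> k)) \<longlonglongrightarrow> h k (Z \<omega> k)"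
    and L: "ess_norm M (\<lambda>\<omega>. ext_norm2 n (\<lambda>k. envelope H k (Z \<omega> k))) = ereal L"
  obtains c where "\<And>k. 0 \<le> c k" "AE \<omega> in M. \<forall>h\<in>H. \<forall>k\<in>{1..n}. \<bar>h k (Z \<omega> k)\<bar> \<le> c k"
    "(\<Sum>k\<in>{1..n}. (c k)\<^sup>2) \<le> L\<^sup>2"
proof -
  define E where "E k x = (real_of_ereal (SUP l. ereal \<bar>g l k x\<bar>))\<^sup>2" for k x
  have env: "envelope H k (Z \<omega> k) = (SUP l. ereal \<bar>g l k (Z \<omega> k)\<bar>)" if "\<omega> \<in> space M" "k \<in> {1..n}" for \<omega> k
  proof (rule envelope_eq_countable_SUP[where g = g, OF g])
    show "\<exists>l. (\<lambda>m. g (l m) k (Z \<omega> k)) \<longlonglongrightarrow> h k (Z \<omega> k)" if "h \<in> H" for h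
      using approx[OF that] \<open>\<omega> \<in> space M\<close> \<open>k \<in> {1..n}\<close> by blast
  qed
  have finite_env: "AE \<omega> in M. (\<forall>k\<in>{1..n}. \<forall>h\<in>H. (h k (Z \<omega> k))\<^sup>2 \<le> E k (Z \<omega> k)) \<and> (\<Sum>k\<in>{1..n}. E k (Z \<omega> k)) \<le> L\<^sup>2"
    using esssup_AE[of "\<lambda>\<omega>. \<bar>ext_norm2 n (\<lambda>k. envelope H k (Z \<omega> k))\<bar>" M] AE_space
  proof eventually_elim
    case (elim \<omega>)
    define a where "a k = envelope H k (Z \<omega> k)" for k
    have sum: "(\<Sum>k\<in>{1..n}. \<bar>a k\<bar>\<^sup>2) \<le> ereal (L\<^sup>2)"
    proof (rule ext_sqrt_le_imp_le_square)
      show "0 \<le> (\<Sum>k\<in>{1..n}. \<bar>a k\<bar>\<^sup>2)" by (intro sum_nonneg) simp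
      have "\<bar>ext_norm2 n a\<bar> \<le> ereal L"
        using elim(1) L unfolding ess_norm_def a_def by simp
      then show "ext_sqrt (\<Sum>k\<in>{1..n}. \<bar>a k\<bar>\<^sup>2) \<le> ereal L"
        unfolding ext_norm2_def[symmetric]
        by (rule order_trans[rotated]) (cases "ext_norm2 n a", auto)
    qed
    have real_a: "\<exists>r. a k = ereal r" if k: "k \<in> {1..n}" for k
    proof -
      have "\<bar>a k\<bar>\<^sup>2 \<le> (\<Sum>k\<in>{1..n}. \<bar>a k\<bar>\<^sup>2)"
        using sum_mono2[of "{1..n}" "{k}" "\<lambda>k. \<bar>a k\<bar>\<^sup>2"] k by auto
      then have "\<bar>a k\<bar>\<^sup>2 \<le> ereal (L\<^sup>2)" using sum by (rule order_trans)
      then show ?thesis by (cases "a k") (auto simp: power2_eq_square)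
    qed
    have a_eq: "\<bar>a k\<bar>\<^sup>2 = ereal (E k (Z \<omega> k))" if k: "k \<in> {1..n}" for k
      using real_a[OF k] env[OF elim(2) k] by (auto simp: a_def E_def)
    have "(\<Sum>k\<in>{1..n}. E k (Z \<omega> k)) \<le> L\<^sup>2"
      using sum a_eq by (simp del: One_nat_def)
    moreover have "(h k (Z \<omega> k))\<^sup>2 \<le> E k (Z \<omega> k)" if k: "k \<in> {1..n}" and h: "h \<in> H" for h k
    proof -
      obtain r where r: "a k = ereal r" using real_a[OF k] by blast
      have "ereal \<bar>h k (Z \<omega> k)\<bar> \<le> a k" unfolding a_def envelope_def using h by (rule SUP_upper)
      then have "\<bar>h k (Z \<omega> k)\<bar> \<le> r" using r by simp
      then have "(h k (Z \<omega> k))\<^sup>2 \<le> r\<^sup>2" using abs_le_square_iff[of "h k (Z \<omega> k)" r] by linarith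
      then show ?thesis using a_eq[OF k] r by simp
    qed
    ultimately show ?case by blast
  qed
  have "E k \<in> borel_measurable (borel_of (S k))" if "k \<in> {1..n}" for k
  proof -
    have [measurable]: "g l k \<in> borel_measurable (borel_of (S k))" for l
      by (rule meas[OF g that])
    show ?thesis unfolding E_def[abs_def] by measurable
  qed
  then have indE: "indep_vars (\<lambda>_. borel) (\<lambda>k \<omega>. E k (Z \<omega> k)) {1..n}"
    by (rule indep_vars_compose2[OF ind])
  obtain t where t: "\<And>k. k \<in> {1..n} \<Longrightarrow> 0 \<le> t k"
      "\<And>k. k \<in> {1..n} \<Longrightarrow> AE \<omega> in M. E k (Z \<omega> k) \<le> t k" "(\<Sum>k\<in>{1..n}. t k) \<le> L\<^sup>2"
  proof (rule indep_sum_bound_imp_component_bounds[OF _ indE])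
    show "AE \<omega> in M. (\<Sum>k\<in>{1..n}. E k (Z \<omega> k)) \<le> L\<^sup>2"
      using finite_env by eventually_elim blast
  qed (auto simp: E_def)
  show thesis
  proof
    show "0 \<le> (if k \<in> {1..n} then sqrt (t k) else 0)" for k using t(1) by simp
    have "AE \<omega> in M. \<forall>k\<in>{1..n}. E k (Z \<omega> k) \<le> t k"
      using t(2) by (intro AE_finite_allI) auto
    with finite_env show "AE \<omega> in M. \<forall>h\<in>H. \<forall>k\<in>{1..n}. \<bar>h k (Z \<omega> k)\<bar> \<le> (if k \<in> {1..n} then sqrt (t k) else 0)"
    proof eventually_elim
      case (elim \<omega>)
      show ?case
      proof (intro ballI)
        fix h k assume hk: "h \<in> H" "k \<in> {1..n}"
        then have "(h k (Z \<omega> k))\<^sup>2 \<le> t k" using elim by (meson order_trans)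
        then show "\<bar>h k (Z \<omega> k)\<bar> \<le> (if k \<in> {1..n} then sqrt (t k) else 0)"
          using hk(2) real_sqrt_le_mono by fastforce
      qed
    qed
    have "(\<Sum>k\<in>{1..n}. (if k \<in> {1..n} then sqrt (t k) else 0)\<^sup>2) = (\<Sum>k\<in>{1..n}. t k)"
      using t(1) by (intro sum.cong) auto
    then show "(\<Sum>k\<in>{1..n}. (if k \<in> {1..n} then sqrt (t k) else 0)\<^sup>2) \<le> L\<^sup>2" using t(3) by simp
  qed
qed

section \<open>Probability bounds for the excess risk\<close>

lemma ext_exp_nonneg: "0 \<le> ext_exp x"
  by (simp add: ext_exp_def)

lemma outer_measure_of_le_prob:
  assumes "prob_space M" "A \<in> sets M" "B \<subseteq> A"
  shows "enn2ereal (outer_measure_of M B) \<le> ereal (measure M A)"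
proof -
  interpret prob_space M by fact
  have "outer_measure_of M B \<le> outer_measure_of M A" by (rule outer_measure_of_mono[OF assms(3)])
  then have "enn2ereal (outer_measure_of M B) \<le> enn2ereal (outer_measure_of M A)"
    by (simp add: less_eq_ennreal.rep_eq)
  then show ?thesis using outer_measure_of_event[OF assms(2)] by simp
qed

theorem corollary3p1:
  fixes M :: "'w measure"
    and n :: nat
    and S :: "nat \<Rightarrow> 'a topology"
    and H :: "(nat \<Rightarrow> 'a \<Rightarrow> real) set"
    and Z Z' :: "'w \<Rightarrow> nat \<Rightarrow> 'a"
    and U :: "'w \<Rightarrow> nat \<Rightarrow> real"
    and htilde :: "nat \<Rightarrow> 'a \<Rightarrow> real"
    and hhat :: "(nat \<Rightarrow> 'a) \<Rightarrow> nat \<Rightarrow> 'a \<Rightarrow> real"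
  assumes "prob_space M"
    and "\<forall>k\<in>{1..n}. Polish_space (S k)"
    and "sequential_family n S H"
    and "pointwise_measurable n S H"
    and "Z \<in> measurable M (prod_borel n S)"
    and "prob_space.indep_vars M (\<lambda>k. borel_of (S k)) (\<lambda>k \<omega>. Z \<omega> k) {1..n}"
    and "\<forall>h\<in>H. \<forall>k\<in>{1..n}. expectation_defined M (\<lambda>\<omega>. ereal (h k (Z \<omega> k)))"
    and "is_arg_min (\<lambda>h. \<Sum>k=1..n. ext_expectation M (\<lambda>\<omega>. ereal (h k (Z \<omega> k)))) (\<lambda>h. h \<in> H) htilde"
    and "\<forall>\<omega>\<in>space M. is_arg_min (\<lambda>h. \<Sum>k=1..n. h k (Z \<omega> k)) (\<lambda>h. h \<in> H) (hhat (Z \<omega>))"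
    and "independent_copy M (prod_borel n S) Z Z'"
    and "rademacher_sequence M n U"
    and "indep_elements M (PiM {1..n} (\<lambda>_. borel)) U (prod_borel n S) Z"
  shows
    "(\<forall>\<epsilon>>0.
        enn2ereal (outer_measure_of M {\<omega>\<in>space M.
            mean_difference M n Z' (hhat (Z \<omega>)) htilde
              > 2 * (ereal \<epsilon> + rademacher_complexity M n U H Z)})
        \<le> 2 * ext_exp (- ((ereal \<epsilon> /
              (ereal (sqrt 2) * ess_norm M (\<lambda>\<omega>. ext_norm2 n (\<lambda>k. envelope H k (Z \<omega> k)))))\<^sup>2)))
     \<and>
     (\<forall>\<delta>. 0 < \<delta> \<and> \<delta> \<le> 2 \<longrightarrow>
        holds_with_prob_at_least M (1 - \<delta>) (\<lambda>\<omega>.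
           mean_difference M n Z' (hhat (Z \<omega>)) htilde
             \<le> 2 * (ess_norm M (\<lambda>\<omega>. ext_norm2 n (\<lambda>k. envelope H k (Z \<omega> k)))
                        * ereal (sqrt (2 * ln (2 / \<delta>)))
                     + rademacher_complexity M n U H Z)))"
proof -
  interpret prob_space M by fact
  let ?L = "ess_norm M (\<lambda>\<omega>. ext_norm2 n (\<lambda>k. envelope H k (Z \<omega> k)))"
  let ?md = "\<lambda>\<omega>. mean_difference M n Z' (hhat (Z \<omega>)) htilde"
  let ?R = "rademacher_complexity M n U H Z"
  note Z = assms(5) and ind = assms(6) and hh = assms(9) and copy = assms(10) and U = assms(11,12)
  have meas: "h k \<in> borel_measurable (borel_of (S k))" if "h \<in> H" "k \<in> {1..n}" for h k
    using assms(3) that unfolding sequential_family_def by blast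
  have ht: "htilde \<in> H" using assms(8) by (simp add: is_arg_min_def)
  obtain g :: "nat \<Rightarrow> nat \<Rightarrow> 'a \<Rightarrow> real" where "range g \<subseteq> H"
    and lim: "\<forall>h\<in>H. \<exists>l :: nat \<Rightarrow> nat. \<forall>z \<in> (\<Pi>\<^sub>E k\<in>{1..n}. topspace (S k)). \<forall>k\<in>{1..n}.
      (\<lambda>m. g (l m) k (z k)) \<longlonglongrightarrow> h k (z k)"
    using assms(4) unfolding pointwise_measurable_def by (elim exE conjE)
  then have g: "g l \<in> H" for l by auto
  have Z_space: "Z \<omega> \<in> (\<Pi>\<^sub>E k\<in>{1..n}. topspace (S k))" if "\<omega> \<in> space M" for \<omega>
    using measurable_space[OF Z that] by (simp add: space_PiM)
  have approx: "\<exists>l. \<forall>\<omega>\<in>space M. \<forall>k\<in>{1..n}. (\<lambda>m. g (l m) k (Z \<omega> k)) \<longlonglongrightarrow> h k (Z \<omega> k)" if "h \<in> H" for h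
    using bspec[OF lim that] Z_space by meson
  have bounds: "\<exists>c. (\<forall>k. 0 \<le> c k) \<and> (AE \<omega> in M. \<forall>h\<in>H. \<forall>k\<in>{1..n}. \<bar>h k (Z \<omega> k)\<bar> \<le> c k) \<and>
      (\<Sum>k\<in>{1..n}. (c k)\<^sup>2) \<le> r\<^sup>2" if "?L = ereal r" for r
  proof (rule envelope_component_bounds[where g = g, OF Z ind])
    show "?L = ereal r" by (rule that)
    show "h k \<in> borel_measurable (borel_of (S k))" if "h \<in> H" "k \<in> {1..n}" for h k
      by (rule meas[OF that])
    show "g l \<in> H" for l by (rule g)
    show "\<exists>l. \<forall>\<omega>\<in>space M. \<forall>k\<in>{1..n}. (\<lambda>m. g (l m) k (Z \<omega> k)) \<longlonglongrightarrow> h k (Z \<omega> k)" if "h \<in> H" for h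
      by (rule approx[OF that])
  qed blast
  have "AE \<omega> in M. 0 \<le> ?L"
    using esssup_AE[of "\<lambda>\<omega>. \<bar>ext_norm2 n (\<lambda>k. envelope H k (Z \<omega> k))\<bar>" M]
    by eventually_elim (auto simp: ess_norm_def intro: order_trans[OF abs_ereal_pos])
  then have "0 \<le> ?L" by simp
  then consider (inf) "?L = \<infinity>" | (zero) "?L = 0" | (pos) L where "?L = ereal L" "0 < L"
    by (cases ?L) force+
  then show ?thesis
  proof cases
    case inf
    have "enn2ereal (outer_measure_of M B) \<le> 2" if "B \<subseteq> space M" for B
    proof -
      have "enn2ereal (outer_measure_of M B) \<le> 1"
        using outer_measure_of_le_prob[OF assms(1) sets.top that] by (simp add: prob_space one_ereal_def)
      then show ?thesis by (rule order_trans) simp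
    qed
    moreover have "holds_with_prob_at_least M (1 - \<delta>) (\<lambda>\<omega>. ?md \<omega> \<le> 2 * (?L * ereal (sqrt (2 * ln (2 / \<delta>))) + ?R))"
      if "0 < \<delta>" "\<delta> \<le> 2" for \<delta> :: real
    proof (cases "\<delta> = 2")
      case True
      then show ?thesis by (auto simp: holds_with_prob_at_least_def intro!: bexI[of _ "{}"])
    next
      case False
      then have "0 < ln (2 / \<delta>)" using that by (intro ln_gt_zero) simp
      then have "2 * (?L * ereal (sqrt (2 * ln (2 / \<delta>))) + ?R) = \<infinity>" by (simp add: inf)
      then show ?thesis using that
        by (auto simp: holds_with_prob_at_least_def prob_space intro!: bexI[of _ "space M"])
    qed
    moreover have "2 * ext_exp (- ((ereal \<epsilon> / (ereal (sqrt 2) * ?L))\<^sup>2)) = 2" for \<epsilon> :: real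
      by (simp add: inf ext_exp_def power2_eq_square one_ereal_def[symmetric])
    ultimately show ?thesis by auto
  next
    case zero
    then obtain c where c_bounds: "\<And>k. 0 \<le> c k" "AE \<omega> in M. \<forall>h\<in>H. \<forall>k\<in>{1..n}. \<bar>h k (Z \<omega> k)\<bar> \<le> c k"
      "(\<Sum>k\<in>{1..n}. (c k)\<^sup>2) \<le> 0\<^sup>2"
      using bounds[of 0] by (auto simp: zero_ereal_def)
    interpret enveloped_family M n S H Z g c
      by unfold_locales (use Z ind meas g approx c_bounds in auto)
    have "(\<Sum>k\<in>{1..n}. (c k)\<^sup>2) = 0" using c_bounds(3) by (intro antisym sum_nonneg) auto
    then have c0: "c k = 0" if "k \<in> {1..n}" for k
      using that by (subst (asm) sum_nonneg_eq_0_iff) auto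
    have R: "0 \<le> ?R" by (rule degenerate_excess(2)[OF copy ht ht U c0])
    have md: "?md \<omega> = 0" if "\<omega> \<in> space M" for \<omega>
      using hh that by (intro degenerate_excess(1)[OF copy _ ht U c0]) (auto simp: is_arg_min_def)
    have "enn2ereal (outer_measure_of M {\<omega>\<in>space M. ?md \<omega> > 2 * (ereal \<epsilon> + ?R)}) \<le> 2 * ext_exp x"
      if "0 < \<epsilon>" for \<epsilon> x
    proof -
      have "{\<omega>\<in>space M. ?md \<omega> > 2 * (ereal \<epsilon> + ?R)} = {}"
        using md R that by (auto simp: not_less intro!: mult_nonneg_nonneg add_nonneg_nonneg)
      then have "enn2ereal (outer_measure_of M {\<omega>\<in>space M. ?md \<omega> > 2 * (ereal \<epsilon> + ?R)}) = 0"
        by (simp only: outer_measure_of_eq[OF sets.empty_sets] emeasure_empty zero_ennreal.rep_eq)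
      then show ?thesis using ext_exp_nonneg[of x] by (simp add: ereal_zero_le_0_iff)
    qed
    moreover have "?md \<omega> \<le> 2 * (?L * ereal x + ?R)" if "\<omega> \<in> space M" for \<omega> x
      using md[OF that] R by (simp add: zero)
    ultimately show ?thesis
      by (auto simp: holds_with_prob_at_least_def prob_space intro!: bexI[of _ "space M"])
  next
    case pos
    obtain c where c_bounds: "\<And>k. 0 \<le> c k" "AE \<omega> in M. \<forall>h\<in>H. \<forall>k\<in>{1..n}. \<bar>h k (Z \<omega> k)\<bar> \<le> c k"
      "(\<Sum>k\<in>{1..n}. (c k)\<^sup>2) \<le> L\<^sup>2"
      using bounds[OF pos(1)] by blast
    interpret enveloped_family M n S H Z g c
      by unfold_locales (use Z ind meas g approx c_bounds in auto)
    note tail = excess_tail[OF copy ht hh U _ c_bounds(3) pos(2)]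
    show ?thesis
    proof (intro conjI allI impI)
      fix \<epsilon> :: real assume "0 < \<epsilon>"
      then obtain A where A: "A \<in> events" "prob A \<le> 2 * exp (- (\<epsilon> / (sqrt 2 * L))\<^sup>2)"
        "\<And>\<omega>. \<omega> \<in> space M - A \<Longrightarrow> ?md \<omega> \<le> 2 * (ereal \<epsilon> + ?R)"
        using tail by blast
      have "enn2ereal (outer_measure_of M {\<omega>\<in>space M. ?md \<omega> > 2 * (ereal \<epsilon> + ?R)}) \<le> ereal (prob A)"
        using A(1,3) by (intro outer_measure_of_le_prob assms(1)) (auto simp: not_less[symmetric])
      also have "\<dots> \<le> ereal (2 * exp (- (\<epsilon> / (sqrt 2 * L))\<^sup>2))" using A(2) by simp
      also have "\<dots> = 2 * ext_exp (- ((ereal \<epsilon> / (ereal (sqrt 2) * ?L))\<^sup>2))"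
        using pos by (simp add: ext_exp_def power2_eq_square)
      finally show "enn2ereal (outer_measure_of M {\<omega>\<in>space M. ?md \<omega> > 2 * (ereal \<epsilon> + ?R)})
        \<le> 2 * ext_exp (- ((ereal \<epsilon> / (ereal (sqrt 2) * ?L))\<^sup>2))" .
    next
      fix \<delta> :: real assume \<delta>: "0 < \<delta> \<and> \<delta> \<le> 2"
      show "holds_with_prob_at_least M (1 - \<delta>) (\<lambda>\<omega>. ?md \<omega> \<le> 2 * (?L * ereal (sqrt (2 * ln (2 / \<delta>))) + ?R))"
      proof (cases "\<delta> = 2")
        case True
        then show ?thesis by (auto simp: holds_with_prob_at_least_def intro!: bexI[of _ "{}"])
      next
        case False
        then have ln: "0 < ln (2 / \<delta>)" using \<delta> by (intro ln_gt_zero) simp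
        define e where "e = L * sqrt (2 * ln (2 / \<delta>))"
        have "0 < e" using pos ln by (simp add: e_def)
        then obtain A where A: "A \<in> events" "prob A \<le> 2 * exp (- (e / (sqrt 2 * L))\<^sup>2)"
          "\<And>\<omega>. \<omega> \<in> space M - A \<Longrightarrow> ?md \<omega> \<le> 2 * (ereal e + ?R)"
          using tail by blast
        \<comment> \<open>\<open>e\<close> was chosen to make the tail bound equal to \<open>\<delta>\<close>\<close>
        have "(e / (sqrt 2 * L))\<^sup>2 = ln (2 / \<delta>)"
          using pos ln by (simp add: e_def power_divide power_mult_distrib)
        then have "prob A \<le> \<delta>" using A(2) \<delta> by (simp add: exp_minus)
        then have "1 - \<delta> \<le> prob (space M - A)" using A(1) by (simp add: prob_compl)
        moreover have "?L * ereal (sqrt (2 * ln (2 / \<delta>))) = ereal e" by (simp add: pos e_def)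
        ultimately show ?thesis
          unfolding holds_with_prob_at_least_def using A by (intro bexI[of _ "space M - A"]) auto
      qed
    qed
  qed
qed

end
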